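(* Let $(G,o)$ be an infinite sourced Eulerian digraph. Then there is at most one proper Gibbs measure on Eulerian paths from $o$ to $\infty$ in $G$.
   Context: A digraph $G=(V,E)$ consists of a countable set of vertices $V$, a countable set of edges $E$, and a map $E\to V\times V$, $e\mapsto(e^-,e^+)$, sending each edge to its tail $e^-$ and head $e^+$ (loops and multiple edges are allowed). The out-degree of $v$ is $\#\{e:e^-=v\}$ and the in-degree of $v$ is $\#\{e:e^+=v\}$. $G$ is locally finite if all in- and out-degrees are finite, and connected if it is connected as an undirected graph. A path in $G$ is a sequence of vertices $(\gamma_i)$ and edges $(\gamma_{i,i+1})$ such that $\gamma_{i,i+1}$ has tail $\gamma_i$ and head $\gamma_{i+1}$ for each $i$. An infinite sourced digraph (with sink at infinity) is a pair $(G,o)$ where $G$ is an infinite, connected, locally finite digraph and $o$ is a distinguished vertex of $G$. It is Eulerian if every vertex other than $o$ has in-degree equal to out-degree, while $o$ has out-degree one higher than its in-degree. An Eulerian path from $a$ to $b$ in a finite digraph is a path starting at $a$, ending at $b$ and crossing every edge exactly once. A proper Gibbs measure on Eulerian paths from $o$ to $\infty$ in $G$ is a probability measure $\mu$ on the space of paths in $G$ such that: (1) $\mu$ is supported on half-infinite paths indexed by $\{0,1,2,\dots\}$ that start at $o$ and cross every edge of $G$ exactly once; (2) if $X$ is a random path with law $\mu$ then, for every $n\geq 0$, the conditional distribution of the first $n$ steps of $X$ given the steps $X$ takes after time $n$ is that of a uniform random Eulerian path from $o$ to $X_n$ in the graph with edge set $\{X_{i,i+1}:0\le i<n\}$ (this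 edge set equals the set of edges of $G$ not crossed after time $n$, so it is determined by the steps after time $n$). *)

theory Defs
  imports "HOL-Probability.Probability" "Graph_Theory.Graph_Theory"
begin

(* The name is qualified because HOL-Analysis also has a (topological) constant "connected". *)
definition infinite_sourced_digraph :: "('a, 'b) pre_digraph \<Rightarrow> 'a \<Rightarrow> bool" where
  "infinite_sourced_digraph G r \<longleftrightarrow>
     wf_digraph G \<and> countable (verts G) \<and> countable (arcs G) \<and>
     infinite (verts G) \<and> Digraph_Component.connected G \<and>
     (\<forall>v \<in> verts G. finite (in_arcs G v) \<and> finite (out_arcs G v)) \<and>
     r \<in> verts G"

definition eulerian_sourced_digraph :: "('a, 'b) pre_digraph \<Rightarrow> 'a \<Rightarrow> bool" where
  "eulerian_sourced_digraph G r \<longleftrightarrow>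
     infinite_sourced_digraph G r \<and>
     (\<forall>v \<in> verts G - {r}. in_degree G v = out_degree G v) \<and>
     out_degree G r = in_degree G r + 1"

(* A half-infinite path is encoded as the sequence whose i-th entry is the pair of its i-th
   vertex and of the edge leading from that vertex to the next one. *)
type_synonym ('a, 'b) ipath = "nat \<Rightarrow> 'a \<times> 'b"

definition path_vert :: "('a, 'b) ipath \<Rightarrow> nat \<Rightarrow> 'a" where
  "path_vert \<gamma> i = fst (\<gamma> i)"

definition path_edge :: "('a, 'b) ipath \<Rightarrow> nat \<Rightarrow> 'b" where
  "path_edge \<gamma> i = snd (\<gamma> i)"

definition is_ipath :: "('a, 'b) pre_digraph \<Rightarrow> ('a, 'b) ipath \<Rightarrow> bool" where
  "is_ipath G \<gamma> \<longleftrightarrow>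
     (\<forall>i. path_vert \<gamma> i \<in> verts G \<and> path_edge \<gamma> i \<in> arcs G \<and>
          tail G (path_edge \<gamma> i) = path_vert \<gamma> i \<and>
          head G (path_edge \<gamma> i) = path_vert \<gamma> (Suc i))"

definition path_space :: "('a, 'b) pre_digraph \<Rightarrow> ('a, 'b) ipath measure" where
  "path_space G =
     restrict_space (PiM UNIV (\<lambda>_. count_space (verts G \<times> arcs G))) {\<gamma>. is_ipath G \<gamma>}"

(* Finite walks follow the convention of Graph_Theory: a walk with given endpoints is the list
   of its arcs. The library notion euler_trail is not used since it also requires every vertex
   to be visited. *)
definition eulerian_path :: "('a, 'b) pre_digraph \<Rightarrow> 'a \<Rightarrow> 'b list \<Rightarrow> 'a \<Rightarrow> bool" where
  "eulerian_path H a p b \<longleftrightarrow> pre_digraph.awalk H a p b \<and> distinct p \<and> set p = arcs H"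

definition first_steps :: "nat \<Rightarrow> ('a, 'b) ipath \<Rightarrow> 'b list" where
  "first_steps n \<gamma> = map (path_edge \<gamma>) [0..<n]"

definition crossed_before ::
  "('a, 'b) pre_digraph \<Rightarrow> nat \<Rightarrow> ('a, 'b) ipath \<Rightarrow> ('a, 'b) pre_digraph" where
  "crossed_before G n \<gamma> =
     G\<lparr>verts := path_vert \<gamma> ` {..n}, arcs := path_edge \<gamma> ` {..<n}\<rparr>"

(* On paths that start at r and cross every edge exactly once, the set here is finite and nonempty (it contains
   first_steps n applied to the path), so that pmf_of_set is the uniform distribution. *)
definition uniform_eulerian_path ::
  "('a, 'b) pre_digraph \<Rightarrow> 'a \<Rightarrow> nat \<Rightarrow> ('a, 'b) ipath \<Rightarrow> 'b list pmf" where
  "uniform_eulerian_path G r n \<gamma> =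
     pmf_of_set {p. eulerian_path (crossed_before G n \<gamma>) r p (path_vert \<gamma> n)}"

(* The sigma-algebra generated by the steps after time n. *)
definition future_algebra :: "('a, 'b) pre_digraph \<Rightarrow> nat \<Rightarrow> ('a, 'b) ipath measure" where
  "future_algebra G n =
     vimage_algebra (space (path_space G)) (\<lambda>\<gamma> i. \<gamma> (n + i)) (path_space G)"

(* Last conjunct: the conditional law of the first n steps given the steps after time n is
   expressed by conditional probabilities, i.e. conditional expectations of indicators. *)
definition proper_gibbs_measure ::
  "('a, 'b) pre_digraph \<Rightarrow> 'a \<Rightarrow> ('a, 'b) ipath measure \<Rightarrow> bool" where
  "proper_gibbs_measure G r \<mu> \<longleftrightarrow>
     prob_space \<mu> \<and> sets \<mu> = sets (path_space G) \<and>
     (AE \<gamma> in \<mu>. path_vert \<gamma> 0 = r \<and> (\<forall>e \<in> arcs G. \<exists>!i. path_edge \<gamma> i = e)) \<and>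
     (\<forall>n A. AE \<gamma> in \<mu>.
        real_cond_exp \<mu> (future_algebra G n) (indicator {\<gamma> \<in> space \<mu>. first_steps n \<gamma> \<in> A}) \<gamma> =
        measure_pmf.prob (uniform_eulerian_path G r n \<gamma>) A)"

end

theory Submission
  imports Defs
begin

text \<open>
  A Gibbs measure is determined by the probabilities of its finite beginnings, so the aim is to show
  that the law of the next step after a given beginning \<open>q\<close>, ending at \<open>a\<close>, does not depend on the
  measure. The Gibbs property says that, given the remaining future, the continuation of \<open>q\<close> up to a
  late time is a uniform Eulerian path of a finite graph. Given the arc through which it leaves \<open>a\<close> for
  the last time, each of the other unused out-arcs of \<open>a\<close> is equally likely to come next
  (\<open>card_first_step\<close>), so what has to be found is the law of this last exit.

  Close the finite path up to a loop at \<open>a\<close> and cut it at its visits to \<open>a\<close>. The key symmetry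
  (\<open>card_origin_eq\<close>) is that the chance for an arc to lie in the loop opened by an out-arc \<open>e\<close> of \<open>a\<close>
  depends only on the tail of the arc, as long as this is not \<open>a\<close>: given two arcs with the same tail
  \<open>w\<close>, the portions of the path from \<open>a\<close> to \<open>w\<close> in their loops can be exchanged. The expected flow of the loop opened by \<open>e\<close> thus pairs with functions
  that are harmonic for random walk on the digraph. Take a finite set \<open>B\<close> and the function \<open>\<phi>\<close> that
  is \<open>0\<close> at \<open>a\<close>, \<open>1\<close> outside \<open>B\<close> and harmonic in between. The pairing expresses \<open>\<phi> (head G e)\<close>
  through the chances that arcs leaving from outside \<open>B\<close> lie in the loop opened by \<open>e\<close>
  (\<open>first_step_estimate\<close>). An arc traversed after the last exit from \<open>a\<close> lies in the loop opened by the
  last exit. Hence, if the path is unlikely to come back to \<open>a\<close> after having left \<open>B\<close>, all these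
  chances are close to the probability that \<open>e\<close> is the last exit, and this probability is close to
  \<open>\<phi> (head G e)\<close>, normalised by the sum over the unused out-arcs of \<open>a\<close>.

  The function \<open>\<phi>\<close> depends on the graph, \<open>q\<close> and \<open>B\<close> alone. A path of a proper Gibbs measure visits \<open>a\<close>
  finitely often, so the error vanishes as \<open>B\<close> grows (\<open>continuation_estimate\<close>,
  \<open>prob_late_visit_tendsto_0\<close>), and two Gibbs measures assign the same probability to every beginning
  (\<open>prob_cylinder_unique\<close>).
\<close>

section \<open>Exchanging blocks of a closed trail\<close>

definition arcs_between :: "'b \<Rightarrow> 'b \<Rightarrow> 'b list \<Rightarrow> 'b list" where
  "arcs_between e f P = takeWhile (\<lambda>x. x \<noteq> f) (dropWhile (\<lambda>x. x \<noteq> e) P)"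

text \<open>
  Exchanges the block that starts at \<open>e\<close> and stops before \<open>f\<close> with the later block that
  starts at \<open>e'\<close> and stops before \<open>f'\<close>. The blocks are located by the arcs at their ends, so
  that the operation is a function of the trail alone; with the roles of \<open>e\<close> and \<open>e'\<close>
  exchanged the same operation undoes it.
\<close>

definition swap_blocks :: "'b \<Rightarrow> 'b \<Rightarrow> 'b \<Rightarrow> 'b \<Rightarrow> 'b list \<Rightarrow> 'b list" where
  "swap_blocks e f e' f' P =
     takeWhile (\<lambda>x. x \<noteq> e) P @ arcs_between e' f' P @ arcs_between f e' P @
     arcs_between e f P @ dropWhile (\<lambda>x. x \<noteq> f') P"

lemma takeWhile_neq_append: "x \<notin> set A \<Longrightarrow> takeWhile (\<lambda>y. y \<noteq> x) (A @ x # B) = A"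
  by (induction A) auto

lemma dropWhile_neq_append: "x \<notin> set A \<Longrightarrow> dropWhile (\<lambda>y. y \<noteq> x) (A @ x # B) = x # B"
  by (induction A) auto

lemma arcs_between_append:
  "x \<notin> set A \<Longrightarrow> y \<notin> set (x # B) \<Longrightarrow> arcs_between x y (A @ (x # B) @ y # C) = x # B"
  unfolding arcs_between_def
  using dropWhile_neq_append[of x A "B @ y # C"] takeWhile_neq_append[of y "x # B" C] by simp

text \<open>
  The case \<open>M = []\<close>, where the blocks are adjacent and \<open>f = e'\<close>, is included: it is the one
  that exchanges two loops at the root.
\<close>

lemma swap_blocks_append:
  assumes "distinct (A @ (e # X) @ M @ (e' # Y) @ f' # R)" and f: "f = hd (M @ [e'])"
  shows "swap_blocks e f e' f' (A @ (e # X) @ M @ (e' # Y) @ f' # R) =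
         A @ (e' # Y) @ M @ (e # X) @ f' # R"
proof -
  let ?P = "A @ (e # X) @ M @ (e' # Y) @ f' # R"
  have 1: "takeWhile (\<lambda>x. x \<noteq> e) ?P = A"
    using takeWhile_neq_append[of e A "X @ M @ (e' # Y) @ f' # R"] assms by simp
  have 2: "arcs_between e' f' ?P = e' # Y"
    using arcs_between_append[of e' "A @ (e # X) @ M" f' Y R] assms by auto
  have 3: "dropWhile (\<lambda>x. x \<noteq> f') ?P = f' # R"
    using dropWhile_neq_append[of f' "A @ (e # X) @ M @ (e' # Y)" R] assms by auto
  have 4: "arcs_between f e' ?P = M \<and> arcs_between e f ?P = e # X"
  proof (cases M)
    case Nil
    then have "dropWhile (\<lambda>x. x \<noteq> e') ?P = e' # Y @ f' # R"
      using dropWhile_neq_append[of e' "A @ (e # X)" "Y @ f' # R"] assms by auto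
    then have "arcs_between e' e' ?P = []" by (simp add: arcs_between_def)
    moreover have "arcs_between e e' ?P = e # X"
      using arcs_between_append[of e A e' X "Y @ f' # R"] assms Nil by auto
    ultimately show ?thesis using f Nil by simp
  next
    case (Cons f0 M')
    then have "arcs_between f0 e' ?P = f0 # M'"
      using arcs_between_append[of f0 "A @ (e # X)" e' M' "Y @ f' # R"] assms by auto
    moreover have "arcs_between e f0 ?P = e # X"
      using arcs_between_append[of e A f0 X "M' @ e' # Y @ f' # R"] assms Cons by auto
    ultimately show ?thesis using f Cons by simp
  qed
  show ?thesis unfolding swap_blocks_def using 1 2 3 4 by simp
qed

context pre_digraph
begin

lemma cas_append_ex: "cas u (p @ q) v \<longleftrightarrow> (\<exists>w. cas u p w \<and> cas w q v)"
  by (induction p arbitrary: u) auto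

lemma cas_exchange:
  assumes "cas a (A @ (e # X) @ M @ (e' # Y) @ f' # R) b"
    and "tail G e = tail G e'" and "tail G (hd (M @ [e'])) = tail G f'"
  shows "cas a (A @ (e' # Y) @ M @ (e # X) @ f' # R) b"
proof -
  obtain w1 w2 w3 w4 where w: "cas a A w1" "cas w1 (e # X) w2" "cas w2 M w3"
      "cas w3 (e' # Y) w4" "cas w4 (f' # R) b"
    using assms(1) unfolding cas_append_ex by blast
  have "w1 = w3" using w(2,4) assms(2) by simp
  moreover have "w2 = w4" using w(3,4,5) assms(3) by (cases M) auto
  ultimately show ?thesis using w unfolding cas_append_ex by blast
qed

text \<open>
  An Eulerian path of a finite graph is made into a closed walk based at its start by letting one
  further arc \<open>g\<close>, traversed last, lead back to the start. Fixing \<open>g\<close> as the last arc keeps the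
  correspondence with paths one to one.
\<close>

definition closed_trails :: "'a \<Rightarrow> 'b set \<Rightarrow> 'b \<Rightarrow> 'b list set" where
  "closed_trails a R g = {P. cas a P a \<and> distinct P \<and> set P = R \<and> P \<noteq> [] \<and> last P = g}"

text \<open>
  A closed trail based at \<open>a\<close> is a succession of loops at \<open>a\<close>, and the loop that contains \<open>f\<close> is
  named by its first arc. For the closing arc \<open>g\<close> this is the arc of the last exit from \<open>a\<close>.
  The value means nothing if \<open>f\<close> is itself the first arc of the trail, so that it is used for
  arcs \<open>f\<close> that do not leave \<open>a\<close>.
\<close>

definition origin :: "'a \<Rightarrow> 'b \<Rightarrow> 'b list \<Rightarrow> 'b" where
  "origin a f P = last (filter (\<lambda>e. tail G e = a) (takeWhile (\<lambda>e. e \<noteq> f) P))"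

lemma origin_append:
  assumes "f \<notin> set (A @ e # X)" "tail G e = a" "\<forall>x \<in> set X. tail G x \<noteq> a"
  shows "origin a f (A @ (e # X) @ f # R) = e"
proof -
  have "filter (\<lambda>e. tail G e = a) X = []" using assms(3) by (simp add: filter_empty_conv)
  then show ?thesis
    unfolding origin_def using assms takeWhile_neq_append[of f "A @ e # X" R] by simp
qed

lemma last_filter_split:
  assumes "filter Q P \<noteq> []"
  obtains A X where "P = A @ (last (filter Q P)) # X" "\<forall>x \<in> set X. \<not> Q x"
     "Q (last (filter Q P))"
proof -
  have "\<exists>x \<in> set P. Q x" using assms by (auto simp: filter_empty_conv)
  then obtain A x X where "P = A @ x # X" "Q x" "\<forall>z \<in> set X. \<not> Q z"
    using split_list_last_prop[of P Q] by auto
  moreover from this have "filter Q X = []" by (simp add: filter_empty_conv)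
  ultimately show ?thesis using that[of A X] by simp
qed

lemma takeWhile_neq_split: "f \<in> set P \<Longrightarrow> \<exists>R. P = takeWhile (\<lambda>e. e \<noteq> f) P @ f # R"
  by (induction P) auto

lemma origin_split:
  assumes "cas a P b" "f \<in> set P" "tail G f \<noteq> a"
  obtains A X R where "P = A @ (origin a f P # X) @ f # R"
     "\<forall>x \<in> set X. tail G x \<noteq> a" "tail G (origin a f P) = a" "f \<notin> set (A @ origin a f P # X)"
proof -
  let ?T = "takeWhile (\<lambda>e. e \<noteq> f) P"
  obtain R where R: "P = ?T @ f # R" using takeWhile_neq_split assms(2) by fast
  have "?T \<noteq> []" "tail G (hd P) = a"
    using assms by (cases P; auto)+
  then have "hd P \<in> set ?T" using R by (metis hd_append2 hd_in_set)
  then have "filter (\<lambda>e. tail G e = a) ?T \<noteq> []"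
    using \<open>tail G (hd P) = a\<close> by (auto simp: filter_empty_conv)
  then obtain A X where "?T = A @ origin a f P # X" "\<forall>x \<in> set X. tail G x \<noteq> a"
      "tail G (origin a f P) = a"
    unfolding origin_def by (rule last_filter_split)
  moreover from this have "f \<notin> set (A @ origin a f P # X)"
    by (metis (mono_tags, lifting) set_takeWhileD)
  ultimately show ?thesis using R that[of A X R] by simp
qed

text \<open>
  If \<open>f\<close> and \<open>f'\<close> leave the same vertex \<open>w\<close>, the parts of their loops that lead from \<open>a\<close> to \<open>w\<close>
  have the same endpoints. Exchanging them gives another Eulerian trail, in which \<open>f\<close> and
  \<open>f'\<close> have exchanged their origins.
\<close>

lemma origin_swap:
  assumes P: "P \<in> closed_trails a R g" and f: "f \<in> set (takeWhile (\<lambda>x. x \<noteq> f') P)" "f' \<in> R"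
    and t: "tail G f = tail G f'" "tail G f \<noteq> a" and ne: "origin a f P \<noteq> origin a f' P"
  defines "P' \<equiv> swap_blocks (origin a f P) f (origin a f' P) f' P"
  shows "P' \<in> closed_trails a R g" "f \<in> set (takeWhile (\<lambda>x. x \<noteq> f') P')"
    "origin a f P' = origin a f' P" "origin a f' P' = origin a f P"
    "swap_blocks (origin a f P') f (origin a f' P') f' P' = P"
proof -
  define d where "d = origin a f P"
  define d' where "d' = origin a f' P"
  note d_defs = d_def [symmetric] d'_def [symmetric]
  have cas: "cas a P a" "distinct P" "set P = R" "last P = g"
    using P by (auto simp: closed_trails_def)
  obtain A' Y S where 1: "P = A' @ (d' # Y) @ f' # S" "\<forall>x \<in> set Y. tail G x \<noteq> a"
      "tail G d' = a" "f' \<notin> set (A' @ d' # Y)"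
    using origin_split[of a P a f'] cas f t unfolding d_defs by metis
  have fin: "f \<in> set (A' @ d' # Y)"
    using f(1) 1(1,4) takeWhile_neq_append[of f' "A' @ d' # Y" S] by simp
  have "f \<in> set A'"
  proof (rule ccontr)
    assume "f \<notin> set A'"
    then have "f \<in> set Y" using fin 1(3) t by auto
    then obtain Y1 Y2 where Y: "Y = Y1 @ f # Y2" "f \<notin> set Y1" by (metis split_list_first)
    have "origin a f (A' @ (d' # Y1) @ f # (Y2 @ f' # S)) = d'"
      using \<open>f \<notin> set A'\<close> Y 1 t by (intro origin_append) auto
    then have "d = d'" unfolding d_def 1(1) Y(1) by simp
    then show False using ne unfolding d_defs by simp
  qed
  then obtain B M where A': "A' = B @ f # M" by (metis split_list)
  have dis: "distinct (B @ f # M @ (d' # Y) @ f' # S)" using 1(1) A' cas(2) by simp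
  obtain A X R1 where 2: "P = A @ (d # X) @ f # R1" "\<forall>x \<in> set X. tail G x \<noteq> a"
      "tail G d = a" "f \<notin> set (A @ d # X)"
    using origin_split[of a P a f] cas set_takeWhileD[OF f(1)] t unfolding d_defs by metis
  have "B = A @ d # X"
  proof -
    have "takeWhile (\<lambda>x. x \<noteq> f) P = A @ d # X"
      using 2 takeWhile_neq_append[of f "A @ d # X" R1] by simp
    moreover have "takeWhile (\<lambda>x. x \<noteq> f) P = B"
      using takeWhile_neq_append[of f B "M @ (d' # Y) @ f' # S"] dis
      unfolding 1(1) A' by simp
    ultimately show ?thesis by simp
  qed
  then have Peq: "P = A @ (d # X) @ (f # M) @ (d' # Y) @ f' # S" using 1(1) A' by simp
  then have disP: "distinct (A @ (d # X) @ (f # M) @ (d' # Y) @ f' # S)" using cas by simp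
  have P'eq: "P' = A @ (d' # Y) @ (f # M) @ (d # X) @ f' # S"
    unfolding P'_def d_defs using swap_blocks_append[OF disP, of f] Peq by simp
  have "cas a (A @ (d # X) @ (f # M) @ (d' # Y) @ f' # S) a" using cas(1) by (simp only: Peq)
  then have "cas a P' a"
    unfolding P'eq by (rule cas_exchange) (use t 1(3) 2(3) in simp_all)
  moreover have "distinct P'" "set P' = R" "P' \<noteq> []" "last P' = g"
    using disP Peq P'eq cas(3,4) by auto
  ultimately show "P' \<in> closed_trails a R g" by (simp add: closed_trails_def)
  have disP': "distinct (A @ (d' # Y) @ (f # M) @ (d # X) @ f' # S)"
    using \<open>distinct P'\<close> P'eq by simp
  have "takeWhile (\<lambda>x. x \<noteq> f') P' = A @ (d' # Y) @ (f # M) @ (d # X)"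
    using takeWhile_neq_append[of f' "A @ (d' # Y) @ (f # M) @ (d # X)" S] disP' P'eq
    by auto
  then show "f \<in> set (takeWhile (\<lambda>x. x \<noteq> f') P')" by simp
  have o1: "origin a f P' = d'"
    unfolding P'eq using origin_append[of f A d' Y a "M @ (d # X) @ f' # S"] 1 disP' by auto
  have o2: "origin a f' P' = d"
    unfolding P'eq using origin_append[of f' "A @ (d' # Y) @ f # M" d X a S] 2 disP' by auto
  show "origin a f P' = origin a f' P" "origin a f' P' = origin a f P"
    using o1 o2 by (simp_all add: d_defs)
  show "swap_blocks (origin a f P') f (origin a f' P') f' P' = P"
    unfolding o1 o2 using swap_blocks_append[OF disP', of f] Peq P'eq by simp
qed

text \<open>
  This is where uniformity of the trail enters: the probability that an arc lies in the loop
  opened by \<open>e\<close> depends on its tail only. The expected flow of that loop is therefore of the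
  form "each vertex other than \<open>a\<close> sends the same amount through all its out-arcs", which is the flow of a
  random walk, and this is what makes discrete potential theory applicable.
\<close>

lemma card_origin_eq:
  assumes "f \<in> R" "f' \<in> R" "tail G f = tail G f'" "tail G f \<noteq> a"
  shows "card {P \<in> closed_trails a R g. origin a f P = e} =
         card {P \<in> closed_trails a R g. origin a f' P = e}"
proof (cases "f = f'")
  case False
  define before where "before P \<longleftrightarrow> f \<in> set (takeWhile (\<lambda>x. x \<noteq> f') P)" for P
  define \<Theta> where "\<Theta> P = (if origin a f P = origin a f' P then P
      else if before P then swap_blocks (origin a f P) f (origin a f' P) f' P
      else swap_blocks (origin a f' P) f' (origin a f P) f P)" for P
  \<comment> \<open>The involution \<open>\<Theta>\<close> needs to know which of the two arcs comes first; the next two facts decide it.\<close>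
  have not_both: "\<not> (f \<in> set (takeWhile (\<lambda>x. x \<noteq> f') P) \<and> f' \<in> set (takeWhile (\<lambda>x. x \<noteq> f) P))"
    for P :: "'b list" by (induction P) auto
  have one: "f \<in> set (takeWhile (\<lambda>x. x \<noteq> f') P) \<or> f' \<in> set (takeWhile (\<lambda>x. x \<noteq> f) P)"
    if "f \<in> set P" "f' \<in> set P" for P :: "'b list" using that False by (induction P) auto
  have inv: "\<Theta> P \<in> closed_trails a R g \<and> origin a f (\<Theta> P) = origin a f' P \<and>
      origin a f' (\<Theta> P) = origin a f P \<and> \<Theta> (\<Theta> P) = P" if P: "P \<in> closed_trails a R g" for P
  proof (cases "origin a f P = origin a f' P")
    case True
    then show ?thesis using P by (simp add: \<Theta>_def)
  next
    case ne: False
    show ?thesis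
    proof (cases "before P")
      case True
      note sw = origin_swap[OF P True[unfolded before_def] assms(2,3,4) ne]
      have "before (\<Theta> P)" using sw(2) ne True by (simp add: \<Theta>_def before_def)
      then show ?thesis using sw ne True
        by (auto simp: \<Theta>_def)
    next
      case nb: False
      have "f' \<in> set (takeWhile (\<lambda>x. x \<noteq> f) P)"
        using one[of P] nb assms P by (auto simp: before_def closed_trails_def)
      note sw = origin_swap[OF P this assms(1) assms(3)[symmetric] _ ne[symmetric]]
      have "\<not> before (\<Theta> P)" using sw(2) ne nb not_both assms by (auto simp: \<Theta>_def before_def)
      then show ?thesis using sw ne nb assms
        by (auto simp: \<Theta>_def)
    qed
  qed
  show ?thesis
    by (rule bij_betw_same_card[of \<Theta>], rule bij_betw_byWitness[where f' = \<Theta>])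
       (use inv in auto)
qed simp

section \<open>Counting trails by their first arc\<close>

lemma finite_closed_trails: "finite R \<Longrightarrow> finite (closed_trails a R g)"
  by (rule finite_subset[OF _ finite_subset_distinct[of R]]) (auto simp: closed_trails_def)

lemma origin_arc:
  assumes "P \<in> closed_trails a R g" "f \<in> R" "tail G f \<noteq> a"
  shows "origin a f P \<in> R" "tail G (origin a f P) = a"
proof -
  have "cas a P a" "f \<in> set P" using assms by (auto simp: closed_trails_def)
  then obtain A X S where *: "P = A @ (origin a f P # X) @ f # S" "tail G (origin a f P) = a"
    using origin_split[OF _ _ assms(3)] by metis
  then have "origin a f P \<in> set P" by (metis in_set_conv_decomp append_Cons)
  then show "origin a f P \<in> R" "tail G (origin a f P) = a"
    using *(2) assms(1) by (auto simp: closed_trails_def)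
qed

lemma last_exit_split:
  assumes "P \<in> closed_trails a R g" "tail G g \<noteq> a"
  obtains A X where "P = A @ origin a g P # X" "\<forall>x \<in> set X. tail G x \<noteq> a"
proof -
  have P: "cas a P a" "g \<in> set P" "distinct P" "last P = g"
    using assms by (auto simp: closed_trails_def)
  define d where "d = origin a g P"
  obtain A X S where *: "P = A @ (d # X) @ g # S" "\<forall>x \<in> set X. tail G x \<noteq> a"
    using origin_split[OF P(1,2) assms(2)] unfolding d_def by metis
  have "S = []"
  proof (rule ccontr)
    assume "S \<noteq> []"
    then have "last P \<in> set S" using *(1) by (metis append_is_Nil_conv last_append last_in_set list.distinct(1) last_ConsR)
    moreover have "g \<notin> set S" using P(3) *(1) by (metis distinct.simps(2) distinct_append)
    ultimately show False using P(4) by simp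
  qed
  then show ?thesis using that[of A "X @ [g]"] * assms(2) unfolding d_def[symmetric] by auto
qed

lemma origin_neq_last:
  assumes "P \<in> closed_trails a R g" "tail G g \<noteq> a" "f \<in> R" "tail G f \<noteq> a"
    and "origin a f P \<noteq> origin a g P"
  obtains A C h where "P = A @ C" "f \<in> set A" "h \<in> set C" "tail G h = a"
proof -
  define d where "d = origin a g P"
  have P: "distinct P" "set P = R"
    using assms by (auto simp: closed_trails_def)
  obtain A X where *: "P = A @ d # X" "\<forall>x \<in> set X. tail G x \<noteq> a"
    using last_exit_split[OF assms(1,2)] unfolding d_def[symmetric] by metis
  have o: "tail G d = a" using origin_arc[of P a R g g] assms P unfolding d_def[symmetric] by (auto simp: closed_trails_def)
  have "f \<in> set A"
  proof (rule ccontr)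
    assume "f \<notin> set A"
    then have "f \<in> set X" using *(1) assms(3,4) P(2) o by (metis Un_iff set_ConsD set_append)
    then obtain X1 X2 where "X = X1 @ f # X2" "f \<notin> set X1" by (metis split_list_first)
    then have "P = A @ (d # X1) @ f # X2" using *(1) by simp
    moreover have "origin a f (A @ (d # X1) @ f # X2) = d"
      using \<open>f \<notin> set A\<close> \<open>f \<notin> set X1\<close> o assms(4) *(2) \<open>X = _\<close>
      by (intro origin_append) auto
    ultimately show False using assms(5) d_def by metis
  qed
  then show ?thesis using that[of A "d # X" d] * o by simp
qed

lemma hd_closed_trail: "P \<in> closed_trails a R g \<Longrightarrow> hd P \<in> R \<and> tail G (hd P) = a"
  by (cases P) (auto simp: closed_trails_def)

lemma hd_neq_origin:
  assumes "P \<in> closed_trails a R g" "tail G g \<noteq> a" "e \<in> R" "tail G e = a" "e \<noteq> hd P"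
  shows "origin a g P \<noteq> hd P"
proof
  assume eq: "origin a g P = hd P"
  have P: "distinct P" "set P = R"
    using assms by (auto simp: closed_trails_def)
  define d where "d = hd P"
  obtain A X where *: "P = A @ d # X" "\<forall>x \<in> set X. tail G x \<noteq> a"
    using last_exit_split[OF assms(1,2)] unfolding eq d_def[symmetric] by metis
  have "A = []"
  proof (cases A)
    case (Cons b A')
    then have "b = d" using *(1) d_def by (metis append_Cons list.sel(1))
    then show ?thesis using P(1) *(1) Cons by simp
  qed
  then have "e \<in> set X" using *(1) assms(3,5) P(2) unfolding d_def[symmetric] by (metis append_Nil set_ConsD)
  then show False using * assms(4) by blast
qed

text \<open>
  Two loops at the root may be exchanged, except the last one, whose end is fixed by \<open>g\<close>. The
  blocks here are everything before \<open>e'\<close>, and everything from \<open>e'\<close> to the last exit.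
\<close>

lemma first_step_swap:
  assumes P: "P \<in> closed_trails a R g" and g: "tail G g \<noteq> a"
    and e': "e' \<in> R" "tail G e' = a" "e' \<noteq> hd P" "e' \<noteq> origin a g P" "hd P \<noteq> origin a g P"
  defines "P' \<equiv> swap_blocks (hd P) e' e' (origin a g P) P"
  shows "P' \<in> closed_trails a R g" "hd P' = e'" "origin a g P' = origin a g P"
    "swap_blocks e' (hd P) (hd P) (origin a g P) P' = P"
proof -
  define d where "d = hd P"
  define l where "l = origin a g P"
  note d_defs = d_def [symmetric] l_def [symmetric]
  have cas: "cas a P a" "distinct P" "set P = R" "last P = g" "P \<noteq> []"
    using P by (auto simp: closed_trails_def)
  have o: "tail G l = a" using origin_arc[of P a R g g] g P cas unfolding d_defs by auto
  have e: "tail G d = a" using hd_closed_trail[OF P] by (simp add: d_def)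
  obtain A X where *: "P = A @ l # X" "\<forall>x \<in> set X. tail G x \<noteq> a"
    using last_exit_split[OF P g] unfolding d_defs by metis
  have "A \<noteq> []" using *(1) e'(5) unfolding d_defs by (metis append_Nil list.sel(1) d_def)
  moreover have "hd A = d" using *(1) \<open>A \<noteq> []\<close> unfolding d_def by (metis hd_append2)
  moreover have "e' \<in> set A" using e' * cas(3) unfolding d_defs by (metis Un_iff set_ConsD set_append)
  ultimately obtain X1 Y1 where A: "A = (d # X1) @ e' # Y1" using e'(3) unfolding d_defs
    by (metis list.exhaust_sel set_ConsD split_list append_Cons)
  have Peq: "P = [] @ (d # X1) @ [] @ (e' # Y1) @ l # X" using * A by simp
  then have disP: "distinct ([] @ (d # X1) @ [] @ (e' # Y1) @ l # X)" using cas(2) by simp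
  have P'eq: "P' = [] @ (e' # Y1) @ [] @ (d # X1) @ l # X"
    unfolding P'_def d_defs using swap_blocks_append[OF disP, of e'] Peq by simp
  have "cas a ([] @ (d # X1) @ [] @ (e' # Y1) @ l # X) a" using cas(1) Peq by metis
  then have "cas a P' a"
    unfolding P'eq by (rule cas_exchange) (use e e' o in simp_all)
  moreover have "distinct P'" "set P' = R" "P' \<noteq> []" "last P' = g"
    using disP Peq P'eq cas(3,4) by auto
  ultimately show "P' \<in> closed_trails a R g" by (simp add: closed_trails_def)
  show "hd P' = e'" using P'eq by simp
  have disP': "distinct ([] @ (e' # Y1) @ [] @ (d # X1) @ l # X)"
    using \<open>distinct P'\<close> P'eq by simp
  show "swap_blocks e' (hd P) (hd P) (origin a g P) P' = P"
    unfolding d_defs using swap_blocks_append[OF disP', of d] Peq P'eq by simp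
  have "X \<noteq> []" using *(1) cas(4) o g by auto
  then obtain X' where X: "X = X' @ [g]"
    using *(1) cas(4) by (metis append_butlast_last_id last_ConsR last_appendR list.distinct(1))
  have "origin a g ((e' # Y1 @ d # X1) @ (l # X') @ g # []) = l"
    using disP' X * o by (intro origin_append) auto
  then show "origin a g P' = origin a g P" unfolding d_defs using P'eq X by simp
qed

lemma card_first_last_eq:
  assumes "e \<in> R" "tail G e = a" "e \<noteq> f" "e' \<in> R" "tail G e' = a" "e' \<noteq> f" "tail G g \<noteq> a"
  shows "card {P \<in> closed_trails a R g. hd P = e \<and> origin a g P = f} =
         card {P \<in> closed_trails a R g. hd P = e' \<and> origin a g P = f}"
proof (cases "e = e'")
  case False
  show ?thesis
  proof (rule bij_betw_same_card[of "swap_blocks e e' e' f"],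
      rule bij_betw_byWitness[where f' = "swap_blocks e' e e f"])
    show "\<forall>P \<in> {P \<in> closed_trails a R g. hd P = e \<and> origin a g P = f}.
        swap_blocks e' e e f (swap_blocks e e' e' f P) = P"
      using first_step_swap(4)[OF _ assms(7) assms(4,5)] False assms by auto
    show "\<forall>P \<in> {P \<in> closed_trails a R g. hd P = e' \<and> origin a g P = f}.
        swap_blocks e e' e' f (swap_blocks e' e e f P) = P"
      using first_step_swap(4)[OF _ assms(7) assms(1,2)] False assms by auto
    show "swap_blocks e e' e' f ` {P \<in> closed_trails a R g. hd P = e \<and> origin a g P = f}
        \<subseteq> {P \<in> closed_trails a R g. hd P = e' \<and> origin a g P = f}"
      using first_step_swap(1-3)[OF _ assms(7) assms(4,5)] False assms by auto
    show "swap_blocks e' e e f ` {P \<in> closed_trails a R g. hd P = e' \<and> origin a g P = f}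
        \<subseteq> {P \<in> closed_trails a R g. hd P = e \<and> origin a g P = f}"
      using first_step_swap(1-3)[OF _ assms(7) assms(1,2)] False assms by auto
  qed
qed simp

lemma card_fibres: "finite A \<Longrightarrow> finite S \<Longrightarrow> h ` A \<subseteq> S \<Longrightarrow> card A = (\<Sum>y\<in>S. card {x \<in> A. h x = y})"
  using sum.group[of A S h "\<lambda>_. 1::nat"] by simp

text \<open>
  Given the last exit, each of the other out-arcs of \<open>a\<close> is equally likely to come first. This
  reduces the law of the first step to that of the last exit.
\<close>

lemma card_first_step:
  assumes R: "finite R" and e: "e \<in> R" "tail G e = a" and g: "tail G g \<noteq> a"
  shows "(card {f \<in> R. tail G f = a} - 1) * card {P \<in> closed_trails a R g. hd P = e} =
         card {P \<in> closed_trails a R g. origin a g P \<noteq> e}"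
proof -
  let ?U = "closed_trails a R g" and ?O = "{f \<in> R. tail G f = a}"
  have fin: "finite ?U" "finite ?O" using R finite_closed_trails by auto
  have gR: "g \<in> R" if "P \<in> ?U" for P using that by (auto simp: closed_trails_def)
  have orO: "origin a g P \<in> ?O" if "P \<in> ?U" for P
    using origin_arc[OF that gR[OF that] g] by simp
  have hdO: "hd P \<in> ?O" if "P \<in> ?U" for P using hd_closed_trail[OF that] by simp
  show ?thesis
  proof (cases "?O = {e}")
    case True
    then have "{P \<in> ?U. origin a g P \<noteq> e} = {}" using orO by blast
    then show ?thesis using True by (simp only:) simp
  next
    case False
    then obtain e2 where e2: "e2 \<in> ?O" "e2 \<noteq> e" using e by blast
    have ne: "hd P \<noteq> origin a g P" if "P \<in> ?U" for P
      using hd_neq_origin[OF that g, of e] hd_neq_origin[OF that g, of e2] e e2 by force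
    have "card {P \<in> ?U. origin a g P \<noteq> e} =
        (\<Sum>f\<in>?O - {e}. card {P \<in> ?U. origin a g P = f})"
      using orO fin by (subst card_fibres[where S = "?O - {e}" and h = "origin a g"])
         (auto intro!: sum.cong arg_cong[where f = card])
    also have "\<dots> = (\<Sum>f\<in>?O - {e}. (card ?O - 1) * card {P \<in> ?U. hd P = e \<and> origin a g P = f})"
    proof (rule sum.cong[OF refl])
      fix f assume f: "f \<in> ?O - {e}"
      have "card {P \<in> ?U. origin a g P = f} =
          (\<Sum>e'\<in>?O - {f}. card {P \<in> ?U. hd P = e' \<and> origin a g P = f})"
        using hdO ne fin by (subst card_fibres[where S = "?O - {f}" and h = hd])
          (auto intro!: sum.cong arg_cong[where f = card])
      also have "\<dots> = (\<Sum>e'\<in>?O - {f}. card {P \<in> ?U. hd P = e \<and> origin a g P = f})"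
        using f e g by (intro sum.cong refl card_first_last_eq) auto
      finally show "card {P \<in> ?U. origin a g P = f} =
          (card ?O - 1) * card {P \<in> ?U. hd P = e \<and> origin a g P = f}"
        using f by simp
    qed
    also have "\<dots> = (card ?O - 1) * card {P \<in> ?U. hd P = e}"
      unfolding sum_distrib_left[symmetric] using orO ne[THEN not_sym] fin
      by (subst card_fibres[where A = "{P \<in> ?U. hd P = e}" and S = "?O - {e}" and h = "origin a g"])
        (auto intro!: sum.cong arg_cong[where f = card])
    finally show ?thesis by simp
  qed
qed

lemma sum_potential_cas:
  fixes \<phi> :: "'a \<Rightarrow> real"
  shows "cas u X v \<Longrightarrow> (\<Sum>f\<leftarrow>X. \<phi> (tail G f) - \<phi> (head G f)) = \<phi> u - \<phi> v"
  by (induction X arbitrary: u) auto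

text \<open>
  The arcs whose origin is \<open>e\<close> form a walk from the head of \<open>e\<close> back to \<open>a\<close>, along which the
  differences of a potential telescope.
\<close>

lemma sum_potential_loop:
  fixes \<phi> :: "'a \<Rightarrow> real"
  assumes P: "P \<in> closed_trails a R g" and e: "e \<in> R" "tail G e = a" and "\<phi> a = 0"
  shows "(\<Sum>f | f \<in> R \<and> tail G f \<noteq> a \<and> origin a f P = e. \<phi> (tail G f) - \<phi> (head G f))
         = \<phi> (head G e)"
proof -
  have cas: "cas a P a" "distinct P" "set P = R" using P by (auto simp: closed_trails_def)
  obtain A C where AC: "P = A @ e # C" using e cas(3) by (metis split_list)
  define X D where "X = takeWhile (\<lambda>f. tail G f \<noteq> a) C" and "D = dropWhile (\<lambda>f. tail G f \<noteq> a) C"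
  have C: "C = X @ D" by (simp add: X_def D_def)
  obtain w where w: "cas (head G e) X w" "cas w D a"
    using cas(1) unfolding AC C by (auto simp: cas_append_ex simp del: cas_append_iff)
  have "w = a"
  proof (cases D)
    case (Cons f D')
    then have "tail G f = a" using hd_dropWhile[of "\<lambda>f. tail G f \<noteq> a" C] unfolding D_def by force
    then show ?thesis using w(2) Cons by simp
  qed (use w in simp)
  have "{f. f \<in> R \<and> tail G f \<noteq> a \<and> origin a f P = e} = set X"
  proof (intro equalityI subsetI)
    fix f assume "f \<in> set X"
    moreover from this obtain X1 X2 where X: "X = X1 @ f # X2" by (metis split_list)
    moreover have no: "\<forall>x \<in> set X. tail G x \<noteq> a" unfolding X_def by (metis (mono_tags, lifting) set_takeWhileD)
    ultimately have "origin a f (A @ (e # X1) @ f # X2 @ D) = e"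
      using cas(2) AC C e(2) by (intro origin_append) auto
    then show "f \<in> {f. f \<in> R \<and> tail G f \<noteq> a \<and> origin a f P = e}"
      using no \<open>f \<in> set X\<close> AC C X cas(3) by auto
  next
    fix f assume f: "f \<in> {f. f \<in> R \<and> tail G f \<noteq> a \<and> origin a f P = e}"
    then have f': "f \<in> set P" "tail G f \<noteq> a" "origin a f P = e" using cas(3) by auto
    obtain A' X' S where *: "P = A' @ (e # X') @ f # S" "\<forall>x \<in> set X'. tail G x \<noteq> a"
      using origin_split[OF cas(1) f'(1,2)] unfolding f'(3) by metis
    have "e \<notin> set A" using cas(2) unfolding AC by simp
    moreover have "e \<notin> set A'" using cas(2) unfolding *(1) by simp
    moreover have "A @ e # C = A' @ e # (X' @ f # S)" using AC *(1) by simp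
    ultimately have "C = X' @ f # S"
      using dropWhile_neq_append[of e A C] dropWhile_neq_append[of e A' "X' @ f # S"]
      by (metis list.inject)
    then show "f \<in> set X" unfolding X_def using * f by (auto simp: takeWhile_append2)
  qed
  moreover have "distinct X" using cas(2) AC C by simp
  ultimately have "(\<Sum>f | f \<in> R \<and> tail G f \<noteq> a \<and> origin a f P = e. \<phi> (tail G f) - \<phi> (head G f)) =
      (\<Sum>f\<leftarrow>X. \<phi> (tail G f) - \<phi> (head G f))"
    by (simp add: sum_list_distinct_conv_sum_set)
  then show ?thesis using sum_potential_cas[OF w(1)] \<open>w = a\<close> assms(4) by simp
qed

lemma sum_card_origin_potential:
  fixes \<phi> :: "'a \<Rightarrow> real"
  assumes "finite R" "e \<in> R" "tail G e = a" "\<phi> a = 0"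
  shows "(\<Sum>f | f \<in> R \<and> tail G f \<noteq> a. real (card {P \<in> closed_trails a R g. origin a f P = e}) *
            (\<phi> (tail G f) - \<phi> (head G f))) = real (card (closed_trails a R g)) * \<phi> (head G e)"
proof -
  let ?U = "closed_trails a R g" and ?F = "{f. f \<in> R \<and> tail G f \<noteq> a}"
  let ?\<psi> = "\<lambda>f. \<phi> (tail G f) - \<phi> (head G f)"
  have fin: "finite ?U" "finite ?F" using assms(1) finite_closed_trails by auto
  have "(\<Sum>f\<in>?F. real (card {P \<in> ?U. origin a f P = e}) * ?\<psi> f) =
      (\<Sum>f\<in>?F. \<Sum>P\<in>?U. if origin a f P = e then ?\<psi> f else 0)"
    using fin by (simp add: sum.If_cases Int_def conj_commute)
  also have "\<dots> = (\<Sum>P\<in>?U. \<Sum>f\<in>?F. if origin a f P = e then ?\<psi> f else 0)" by (rule sum.swap)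
  also have "\<dots> = (\<Sum>P\<in>?U. \<phi> (head G e))"
  proof (rule sum.cong[OF refl])
    fix P assume "P \<in> ?U"
    from sum_potential_loop[where \<phi> = \<phi>, OF this assms(2-4)]
    show "(\<Sum>f\<in>?F. if origin a f P = e then ?\<psi> f else 0) = \<phi> (head G e)"
      using fin by (simp add: sum.If_cases Int_def conj_ac)
  qed
  finally show ?thesis by simp
qed

text \<open>
  Average the telescoping identity over all trails. The weight of an arc depends on its tail
  only, so the contributions of a vertex where \<open>\<phi>\<close> is harmonic cancel, and \<open>\<phi> (head G e)\<close> becomes
  a combination of the frequencies with which \<open>e\<close> is the origin of the arcs leaving from outside
  \<open>B\<close>. Each of these differs from the frequency of \<open>e\<close> as last exit by at most the proportion of
  trails in \<open>D\<close>; such a trail returns to \<open>a\<close> after having left \<open>B\<close> (\<open>origin_neq_last\<close>). Hence the law of the last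
  exit, and with it that of the first step, is governed by \<open>\<phi>\<close> up to that error, whatever the graph
  looks like outside \<open>B\<close>.
\<close>

theorem first_step_estimate:
  fixes \<phi> :: "'a \<Rightarrow> real" and B :: "'a set" and \<Phi> :: real
  assumes R: "finite R" and e: "e \<in> R" "tail G e = a" and g: "g \<in> R" "tail G g \<notin> B" and a: "a \<in> B"
    and \<phi>: "\<phi> a = 0" "\<And>v. v \<notin> B \<Longrightarrow> \<phi> v = 1" "\<And>v. \<phi> v \<le> 1"
    and harmonic: "\<And>v. v \<in> B \<Longrightarrow> v \<noteq> a \<Longrightarrow> (\<Sum>f | f \<in> R \<and> tail G f = v. \<phi> v - \<phi> (head G f)) = 0"
  defines "U \<equiv> closed_trails a R g" and "Out \<equiv> {f \<in> R. tail G f = a}"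
  defines "\<Phi> \<equiv> \<Sum>f\<in>Out. \<phi> (head G f)"
  defines "D \<equiv> {P \<in> U. \<exists>f\<in>R. tail G f \<notin> B \<and> origin a f P \<noteq> origin a g P}"
  shows "\<bar>\<Phi> * (card U - real (card Out - 1) * card {P \<in> U. hd P = e}) - \<phi> (head G e) * card U\<bar>
           \<le> \<Phi> * card D" (is ?est)
    and "U \<noteq> {} \<Longrightarrow> head G g = a \<Longrightarrow> 1 \<le> \<Phi>"
proof -
  define K where "K f h = real (card {P \<in> U. origin a f P = h})" for f h
  define \<psi> where "\<psi> f = \<phi> (tail G f) - \<phi> (head G f)" for f
  define S where "S = {f \<in> R. tail G f \<notin> B}"
  define \<Psi> where "\<Psi> = sum \<psi> S"
  have ga: "tail G g \<noteq> a" using g a by auto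
  have fin: "finite U" "finite S" "finite Out"
    using R finite_closed_trails by (auto simp: U_def S_def Out_def)
  \<comment> \<open>Vertices of \<open>B\<close> other than \<open>a\<close> contribute nothing: the weight comes out of a harmonic sum.\<close>
  have interior: "(\<Sum>f | f \<in> R \<and> tail G f \<noteq> a. K f h * \<psi> f) = (\<Sum>f\<in>S. K f h * \<psi> f)" for h
  proof -
    let ?I = "{f \<in> R. tail G f \<in> B \<and> tail G f \<noteq> a}"
    have split: "{f. f \<in> R \<and> tail G f \<noteq> a} = S \<union> ?I" using a by (auto simp: S_def)
    have "(\<Sum>f\<in>?I. K f h * \<psi> f) = (\<Sum>v\<in>tail G ` ?I. \<Sum>f | f \<in> ?I \<and> tail G f = v. K f h * \<psi> f)"
      using R by (intro sum.group[symmetric]) auto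
    also have "\<dots> = (\<Sum>v\<in>tail G ` ?I. 0)"
    proof (rule sum.cong[OF refl])
      fix v assume "v \<in> tail G ` ?I"
      then obtain f0 where f0: "f0 \<in> R" "v = tail G f0" "v \<in> B" "v \<noteq> a" by auto
      have "(\<Sum>f | f \<in> ?I \<and> tail G f = v. K f h * \<psi> f) = (\<Sum>f | f \<in> R \<and> tail G f = v. K f0 h * \<psi> f)"
      proof (rule sum.cong)
        fix f assume "f \<in> {f. f \<in> R \<and> tail G f = v}"
        then have "K f h = K f0 h"
          unfolding K_def U_def using f0 by (subst card_origin_eq[of f R f0]) auto
        then show "K f h * \<psi> f = K f0 h * \<psi> f" by simp
      qed (use f0 in auto)
      also have "\<dots> = K f0 h * (\<Sum>f | f \<in> R \<and> tail G f = v. \<phi> v - \<phi> (head G f))"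
        unfolding sum_distrib_left \<psi>_def by (intro sum.cong) auto
      finally show "(\<Sum>f | f \<in> ?I \<and> tail G f = v. K f h * \<psi> f) = 0"
        using harmonic f0 by simp
    qed
    finally show ?thesis
      unfolding split using R fin by (subst sum.union_disjoint) (auto simp: S_def)
  qed
  have flow: "(\<Sum>f\<in>S. K f h * \<psi> f) = card U * \<phi> (head G h)" if "h \<in> Out" for h
    using sum_card_origin_potential[where \<phi> = \<phi> and e = h and g = g, OF R] that \<phi>(1) interior[of h]
    unfolding K_def \<psi>_def U_def Out_def by simp
  \<comment> \<open>Summing over all possible origins identifies the boundary mass with \<open>\<Phi>\<close>.\<close>
  have total: "card U * \<Phi> = card U * \<Psi>"
  proof -
    have "(\<Sum>h\<in>Out. K f h) = card U" if "f \<in> S" for f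
      unfolding K_def of_nat_sum[symmetric] of_nat_eq_iff
      using that a fin origin_arc[of _ a R g f]
      by (intro card_fibres[symmetric]) (auto simp: S_def Out_def U_def)
    then have "card U * \<Psi> = (\<Sum>f\<in>S. (\<Sum>h\<in>Out. K f h) * \<psi> f)"
      unfolding \<Psi>_def sum_distrib_left by (intro sum.cong) auto
    also have "\<dots> = (\<Sum>h\<in>Out. \<Sum>f\<in>S. K f h * \<psi> f)"
      unfolding sum_distrib_right by (rule sum.swap)
    also have "\<dots> = card U * \<Phi>" unfolding \<Phi>_def sum_distrib_left using flow by (intro sum.cong) auto
    finally show ?thesis by (rule sym)
  qed
  have \<psi>_nonneg: "0 \<le> \<psi> f" if "f \<in> S" for f using that \<phi> by (auto simp: S_def \<psi>_def)
  show "1 \<le> \<Phi>" if "U \<noteq> {}" "head G g = a"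
  proof -
    have "1 = \<psi> g" using g \<phi> that by (simp add: \<psi>_def)
    also have "\<dots> \<le> \<Psi>" unfolding \<Psi>_def using g fin \<psi>_nonneg by (intro member_le_sum) (auto simp: S_def)
    also have "\<Psi> = \<Phi>" using total that fin by simp
    finally show ?thesis .
  qed
  have close: "\<bar>K f e - K g e\<bar> \<le> card D" if f: "f \<in> S" for f
  proof -
    have 1: "{P \<in> U. origin a f P = e} \<subseteq> {P \<in> U. origin a g P = e} \<union> D"
      and 2: "{P \<in> U. origin a g P = e} \<subseteq> {P \<in> U. origin a f P = e} \<union> D"
      using f by (auto simp: D_def S_def)
    have finD: "finite D" using fin by (simp add: D_def)
    have "card {P \<in> U. origin a f P = e} \<le> card {P \<in> U. origin a g P = e} + card D"
      by (rule order_trans[OF card_mono[OF _ 1] card_Un_le]) (use fin finD in auto)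
    moreover have "card {P \<in> U. origin a g P = e} \<le> card {P \<in> U. origin a f P = e} + card D"
      by (rule order_trans[OF card_mono[OF _ 2] card_Un_le]) (use fin finD in auto)
    ultimately show ?thesis unfolding K_def by linarith
  qed
  have e_Out: "e \<in> Out" using e by (simp add: Out_def)
  have "\<bar>card U * \<phi> (head G e) - K g e * \<Psi>\<bar> = \<bar>\<Sum>f\<in>S. (K f e - K g e) * \<psi> f\<bar>"
    unfolding flow[OF e_Out, symmetric] \<Psi>_def sum_distrib_left
    by (simp add: sum_subtractf left_diff_distrib)
  also have "\<dots> \<le> (\<Sum>f\<in>S. \<bar>(K f e - K g e) * \<psi> f\<bar>)" by (rule sum_abs)
  also have "\<dots> \<le> (\<Sum>f\<in>S. card D * \<psi> f)"
    using close \<psi>_nonneg by (intro sum_mono) (auto simp: abs_mult intro!: mult_right_mono)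
  finally have main: "\<bar>card U * \<phi> (head G e) - K g e * \<Psi>\<bar> \<le> card D * \<Psi>"
    by (simp add: \<Psi>_def sum_distrib_left)
  have "real (card Out - 1) * card {P \<in> U. hd P = e} = card {P \<in> U. origin a g P \<noteq> e}"
    unfolding U_def Out_def card_first_step[OF R e ga, symmetric] by (rule of_nat_mult[symmetric])
  also have "\<dots> = card U - K g e"
  proof -
    have "card U = card {P \<in> U. origin a g P = e} + card {P \<in> U. origin a g P \<noteq> e}"
      using fin by (subst card_Un_disjoint[symmetric]) (auto intro!: arg_cong[where f = card])
    then show ?thesis by (simp add: K_def)
  qed
  finally have "card U - real (card Out - 1) * card {P \<in> U. hd P = e} = K g e" by simp
  moreover have "\<bar>\<Phi> * K g e - \<phi> (head G e) * card U\<bar> \<le> \<Phi> * card D"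
  proof (cases "U = {}")
    case True
    then show ?thesis by (simp add: K_def D_def)
  next
    case False
    then have "\<Phi> = \<Psi>" using total fin by simp
    then show ?thesis using main by (simp add: mult.commute abs_minus_commute)
  qed
  ultimately show ?est by simp
qed

end

section \<open>Existence of the potential\<close>

text \<open>
  The value at \<open>v\<close> is the probability that the random walk along the arcs \<open>N\<close>, started at \<open>v\<close>,
  does not visit \<open>a\<close> before it leaves \<open>B\<close>. It is obtained as the decreasing limit of the iterates of
  the averaging operator.
\<close>

lemma exists_potential:
  fixes N :: "'a \<Rightarrow> 'b set" and h :: "'b \<Rightarrow> 'a"
  assumes fin: "\<And>v. finite (N v)" and "a \<in> B"
  obtains \<phi> :: "'a \<Rightarrow> real" where "\<phi> a = 0" "\<And>v. v \<notin> B \<Longrightarrow> \<phi> v = 1" "\<And>v. \<phi> v \<le> 1"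
    "\<And>v. v \<in> B \<Longrightarrow> v \<noteq> a \<Longrightarrow> (\<Sum>f\<in>N v. \<phi> v - \<phi> (h f)) = 0"
proof -
  define T :: "('a \<Rightarrow> real) \<Rightarrow> 'a \<Rightarrow> real" where
    "T \<phi> v = (if v = a then 0 else if v \<notin> B \<or> N v = {} then 1
                else (\<Sum>f\<in>N v. \<phi> (h f)) / card (N v))" for \<phi> v
  define \<phi> where "\<phi> n = (T ^^ n) (\<lambda>_. 1)" for n
  have step: "\<phi> (Suc n) = T (\<phi> n)" for n by (simp add: \<phi>_def)
  have mono: "T \<phi>1 v \<le> T \<phi>2 v" if "\<And>v. \<phi>1 v \<le> \<phi>2 v" for \<phi>1 \<phi>2 v
    using that by (auto simp: T_def intro!: divide_right_mono sum_mono)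
  have nonneg: "0 \<le> \<phi> n v" for n v
    by (induction n arbitrary: v) (auto simp: step T_def intro!: divide_nonneg_nonneg sum_nonneg, simp add: \<phi>_def)
  have dec: "\<phi> (Suc n) v \<le> \<phi> n v" for n v
  proof (induction n arbitrary: v)
    case 0
    have "(\<Sum>f\<in>N v. \<phi> 0 (h f)) / card (N v) \<le> 1" by (simp add: \<phi>_def)
    then show ?case by (auto simp: step T_def) (auto simp: \<phi>_def)
  next
    case (Suc n)
    show ?case unfolding step[of "Suc n"] by (subst step) (intro mono Suc)
  qed
  have "\<exists>L. (\<lambda>n. \<phi> n v) \<longlonglongrightarrow> L" for v
    using decseq_convergent[of "\<lambda>n. \<phi> n v" 0] dec nonneg by (metis decseq_SucI)
  then obtain L where L: "\<And>v. (\<lambda>n. \<phi> n v) \<longlonglongrightarrow> L v" by metis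
  have Lim: "(\<lambda>n. T (\<phi> n) v) \<longlonglongrightarrow> T L v" for v
    using L fin by (auto simp: T_def intro!: tendsto_intros)
  have fix_T: "T L v = L v" for v
    using LIMSEQ_unique[OF Lim[of v, folded step]] LIMSEQ_Suc[OF L[of v]] by simp
  have "L v \<le> 1" for v
  proof (rule LIMSEQ_le_const2[OF L])
    have "\<phi> n v \<le> 1" for n
    proof (induction n)
      case (Suc n)
      then show ?case using dec[of n v] by linarith
    qed (simp add: \<phi>_def)
    then show "\<exists>N. \<forall>n\<ge>N. \<phi> n v \<le> 1" by blast
  qed
  moreover have "(\<Sum>f\<in>N v. L v - L (h f)) = 0" if "v \<in> B" "v \<noteq> a" for v
  proof (cases "N v = {}")
    case False
    then have "L v = (\<Sum>f\<in>N v. L (h f)) / card (N v)" using fix_T[of v] that by (simp add: T_def)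
    moreover have "real (card (N v)) > 0" using False fin by (simp add: card_gt_0_iff)
    ultimately have "card (N v) * L v = (\<Sum>f\<in>N v. L (h f))" by (simp add: field_simps)
    then show ?thesis by (simp add: sum_subtractf)
  qed simp
  moreover have "L a = 0" "\<And>v. v \<notin> B \<Longrightarrow> L v = 1"
    using fix_T \<open>a \<in> B\<close> by (metis T_def)+
  ultimately show ?thesis using that[of L] by blast
qed

section \<open>Path measures and cylinder sets\<close>

lemma space_path_space: "space (path_space G) = {\<gamma>. is_ipath G \<gamma>}"
  by (auto simp: path_space_def space_restrict_space space_PiM is_ipath_def path_vert_def
      path_edge_def mem_Times_iff)

lemma measurable_path_entry: "(\<lambda>\<gamma>. \<gamma> i) \<in> path_space G \<rightarrow>\<^sub>M count_space (verts G \<times> arcs G)"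
  unfolding path_space_def by (rule measurable_restrict_space1) simp

lemma measurable_path_edge: "(\<lambda>\<gamma>. path_edge \<gamma> i) \<in> path_space G \<rightarrow>\<^sub>M count_space (arcs G)"
  unfolding path_edge_def
  by (rule measurable_compose[OF measurable_path_entry]) (auto simp: measurable_count_space_eq1)

lemma first_steps_0 [simp]: "first_steps 0 \<gamma> = []"
  by (simp add: first_steps_def)

lemma first_steps_Suc: "first_steps (Suc n) \<gamma> = first_steps n \<gamma> @ [path_edge \<gamma> n]"
  by (simp add: first_steps_def)

lemma length_first_steps [simp]: "length (first_steps n \<gamma>) = n"
  by (simp add: first_steps_def)

lemma nth_first_steps [simp]: "i < n \<Longrightarrow> first_steps n \<gamma> ! i = path_edge \<gamma> i"
  by (simp add: first_steps_def)

lemma set_first_steps: "set (first_steps n \<gamma>) = path_edge \<gamma> ` {..<n}"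
  by (auto simp: first_steps_def)

lemma take_first_steps: "k \<le> n \<Longrightarrow> take k (first_steps n \<gamma>) = first_steps k \<gamma>"
  by (intro nth_equalityI) auto

definition cylinder :: "('a, 'b) pre_digraph \<Rightarrow> 'b list \<Rightarrow> ('a, 'b) ipath set" where
  "cylinder G p = {\<gamma>. is_ipath G \<gamma> \<and> first_steps (length p) \<gamma> = p}"

lemma sets_cylinder: "cylinder G p \<in> sets (path_space G)"
proof (cases "set p \<subseteq> arcs G")
  case True
  have "cylinder G p = {\<gamma> \<in> space (path_space G). \<forall>i\<in>{..<length p}. path_edge \<gamma> i \<in> {p ! i}}"
    by (auto simp: cylinder_def space_path_space list_eq_iff_nth_eq)
  also have "\<dots> \<in> sets (path_space G)"
  proof (rule sets.sets_Collect_finite_All)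
    fix i assume "i \<in> {..<length p}"
    then show "{\<gamma> \<in> space (path_space G). path_edge \<gamma> i \<in> {p ! i}} \<in> sets (path_space G)"
      using True by (intro measurable_sets_Collect[OF measurable_path_edge]) (auto simp: Collect_conv_if)
  qed simp
  finally show ?thesis .
next
  case False
  then obtain i where "i < length p" "p ! i \<notin> arcs G" by (metis in_set_conv_nth subsetI)
  then have "cylinder G p = {}"
    by (auto simp: cylinder_def is_ipath_def) (metis nth_first_steps)
  then show ?thesis by simp
qed

lemma measurable_first_steps:
  assumes "countable (arcs G)"
  shows "first_steps n \<in> path_space G \<rightarrow>\<^sub>M count_space UNIV"
proof -
  have "first_steps n \<in> path_space G \<rightarrow>\<^sub>M count_space (lists (arcs G))"
  proof (rule measurable_count_space_eq_countable[THEN iffD2])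
    show "countable (lists (arcs G))" using assms by simp
    have "first_steps n -` {p} \<inter> space (path_space G) = (if length p = n then cylinder G p else {})" for p
      by (auto simp: cylinder_def space_path_space)
    then show "first_steps n \<in> space (path_space G) \<rightarrow> lists (arcs G) \<and>
        (\<forall>p\<in>lists (arcs G). first_steps n -` {p} \<inter> space (path_space G) \<in> sets (path_space G))"
      by (auto simp: sets_cylinder space_path_space set_first_steps is_ipath_def)
  qed
  then show ?thesis by (rule measurable_compose) simp
qed

text \<open>
  Since the vertices of a path are the tails of its arcs, cylinder sets of arcs generate the
  whole \<open>\<sigma>\<close>-algebra.
\<close>

lemma path_measure_eqI:
  assumes "prob_space M" "prob_space N" and sets: "sets M = sets (path_space G)" "sets N = sets (path_space G)"
    and G: "countable (verts G)" "countable (arcs G)" and eq: "\<And>p. measure M (cylinder G p) = measure N (cylinder G p)"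
  shows "M = N"
proof -
  interpret M: prob_space M by fact
  interpret N: prob_space N by fact
  let ?\<Omega> = "space (path_space G)" and ?E = "insert {} (range (cylinder G))"
  have EP: "?E \<subseteq> Pow ?\<Omega>" by (auto simp: cylinder_def space_path_space)
  have nested: "cylinder G p \<inter> cylinder G q = (if take (length p) q = p then cylinder G q else {})"
    if "length p \<le> length q" for p q
  proof -
    have "\<gamma> \<in> cylinder G p \<and> \<gamma> \<in> cylinder G q \<longleftrightarrow> take (length p) q = p \<and> \<gamma> \<in> cylinder G q" for \<gamma>
      using take_first_steps[OF that, of \<gamma>] by (auto simp: cylinder_def)
    then show ?thesis by auto
  qed
  have "Int_stable ?E"
  proof (rule Int_stableI)
    fix a b assume ab: "a \<in> ?E" "b \<in> ?E"
    show "a \<inter> b \<in> ?E"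
    proof (cases "a = {} \<or> b = {}")
      case False
      then obtain p q where pq: "a = cylinder G p" "b = cylinder G q" using ab by auto
      show ?thesis
        using nested[of p q] nested[of q p] pq by (cases "length p \<le> length q") (auto simp: Int_commute)
    qed auto
  qed
  moreover have "sets (path_space G) = sigma_sets ?\<Omega> ?E"
  proof
    show "sigma_sets ?\<Omega> ?E \<subseteq> sets (path_space G)"
      by (rule sets.sigma_sets_subset) (auto simp: sets_cylinder)
    define S where "S = sigma ?\<Omega> ?E"
    have space_S: "space S = {\<gamma>. is_ipath G \<gamma>}" and sets_S: "sets S = sigma_sets ?\<Omega> ?E"
      using EP by (simp_all add: S_def space_measure_of_conv sets_measure_of_conv space_path_space)
    have cyl: "cylinder G p \<in> sets S" for p by (auto simp: sets_S)
    have "(\<lambda>\<gamma>. \<gamma>) \<in> S \<rightarrow>\<^sub>M path_space G"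
      unfolding path_space_def
    proof (rule measurable_restrict_space2)
      show "(\<lambda>\<gamma>. \<gamma>) \<in> space S \<rightarrow> {\<gamma>. is_ipath G \<gamma>}" by (auto simp: space_S space_path_space)
      have "(\<lambda>\<gamma>. \<gamma> i) \<in> S \<rightarrow>\<^sub>M count_space (verts G \<times> arcs G)" for i
      proof (rule measurable_count_space_eq_countable[THEN iffD2])
        show "countable (verts G \<times> arcs G)" using G by simp
        have "(\<lambda>\<gamma>. \<gamma> i) -` {(v, e)} \<inter> space S \<in> sets S" for v e
        proof (cases "tail G e = v")
          case True
          have "(\<lambda>\<gamma>. \<gamma> i) -` {(v, e)} \<inter> space S =
              (\<Union>p\<in>{p \<in> lists (arcs G). length p = i}. cylinder G (p @ [e]))"
          proof (intro equalityI subsetI)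
            fix \<gamma> assume "\<gamma> \<in> (\<lambda>\<gamma>. \<gamma> i) -` {(v, e)} \<inter> space S"
            then have "\<gamma> i = (v, e)" "is_ipath G \<gamma>" by (auto simp: space_S space_path_space)
            then have "first_steps i \<gamma> \<in> {p \<in> lists (arcs G). length p = i}"
              "\<gamma> \<in> cylinder G (first_steps i \<gamma> @ [e])"
              by (auto simp: set_first_steps is_ipath_def cylinder_def first_steps_Suc path_edge_def)
            then show "\<gamma> \<in> (\<Union>p\<in>{p \<in> lists (arcs G). length p = i}. cylinder G (p @ [e]))" by blast
          next
            fix \<gamma> assume "\<gamma> \<in> (\<Union>p\<in>{p \<in> lists (arcs G). length p = i}. cylinder G (p @ [e]))"
            then have "is_ipath G \<gamma>" "path_edge \<gamma> i = e"
              by (auto simp: cylinder_def first_steps_Suc)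
            then show "\<gamma> \<in> (\<lambda>\<gamma>. \<gamma> i) -` {(v, e)} \<inter> space S"
              using True by (auto simp: space_S space_path_space is_ipath_def path_vert_def path_edge_def prod_eq_iff)
          qed
          also have "\<dots> \<in> sets S"
            using G(2) by (intro sets.countable_UN'' cyl countable_subset[OF _ countable_lists]) auto
          finally show ?thesis .
        next
          case False
          then have "(\<lambda>\<gamma>. \<gamma> i) -` {(v, e)} \<inter> space S = {}"
            by (auto simp: space_S space_path_space is_ipath_def path_vert_def path_edge_def)
               (metis fst_conv snd_conv)
          then show ?thesis by simp
        qed
        then show "(\<lambda>\<gamma>. \<gamma> i) \<in> space S \<rightarrow> verts G \<times> arcs G \<and>
            (\<forall>y\<in>verts G \<times> arcs G. (\<lambda>\<gamma>. \<gamma> i) -` {y} \<inter> space S \<in> sets S)"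
          by (auto simp: space_S space_path_space is_ipath_def path_vert_def path_edge_def mem_Times_iff)
      qed
      then show "(\<lambda>\<gamma>. \<gamma>) \<in> S \<rightarrow>\<^sub>M Pi\<^sub>M UNIV (\<lambda>_. count_space (verts G \<times> arcs G))"
        by (intro measurable_PiM_single')
          (auto simp: space_S space_PiM is_ipath_def path_vert_def path_edge_def mem_Times_iff)
    qed
    then have "(\<lambda>\<gamma>. \<gamma>) -` X \<inter> space S \<in> sets S" if "X \<in> sets (path_space G)" for X
      using that by (rule measurable_sets)
    moreover have "(\<lambda>\<gamma>. \<gamma>) -` X \<inter> space S = X" if "X \<in> sets (path_space G)" for X
      using sets.sets_into_space[OF that] by (auto simp: space_S space_path_space)
    ultimately show "sets (path_space G) \<subseteq> sigma_sets ?\<Omega> ?E"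
      unfolding sets_S by fastforce
  qed
  moreover have "emeasure M X = emeasure N X" if "X \<in> ?E" for X
    using that eq by (auto simp: M.emeasure_eq_measure N.emeasure_eq_measure)
  moreover have "cylinder G [] = ?\<Omega>" by (simp add: cylinder_def space_path_space)
  ultimately show ?thesis
    using EP sets
    by (intro measure_eqI_generator_eq[of ?E ?\<Omega> M N "\<lambda>_. ?\<Omega>"])
       (auto simp: M.emeasure_eq_measure)
qed

section \<open>Exchangeability of the first steps\<close>

lemma (in pre_digraph) cas_first_steps:
  "is_ipath G \<gamma> \<Longrightarrow> cas (path_vert \<gamma> 0) (first_steps n \<gamma>) (path_vert \<gamma> n)"
  by (induction n) (auto simp: first_steps_Suc cas_append_ex is_ipath_def simp del: cas_append_iff)

lemma (in pre_digraph) cas_unique: "cas u p v \<Longrightarrow> cas u p w \<Longrightarrow> v = w"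
  by (induction p arbitrary: u) auto

lemma cas_crossed_before: "pre_digraph.cas (crossed_before G n \<gamma>) = pre_digraph.cas G"
proof (intro ext)
  fix u p v
  show "pre_digraph.cas (crossed_before G n \<gamma>) u p v = pre_digraph.cas G u p v"
    by (induction p arbitrary: u) (auto simp: pre_digraph.cas.simps crossed_before_def)
qed

lemma eulerian_path_crossed_before:
  "eulerian_path (crossed_before G n \<gamma>) (path_vert \<gamma> 0) p x \<longleftrightarrow>
   pre_digraph.cas G (path_vert \<gamma> 0) p x \<and> distinct p \<and> set p = path_edge \<gamma> ` {..<n}"
  unfolding eulerian_path_def pre_digraph.awalk_def cas_crossed_before
  by (auto simp: crossed_before_def)

locale gibbs_measure = wf_digraph G + prob_space \<mu>
  for G :: "('a, 'b) pre_digraph" and \<mu> :: "('a, 'b) ipath measure" +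
  fixes r :: 'a
  assumes countable_verts: "countable (verts G)" and countable_arcs: "countable (arcs G)"
    and finite_out_arcs: "v \<in> verts G \<Longrightarrow> finite (out_arcs G v)"
    and gibbs: "proper_gibbs_measure G r \<mu>"
begin

lemma sets_path [simp]: "sets \<mu> = sets (path_space G)"
  using gibbs by (simp add: proper_gibbs_measure_def)

lemma space_path [simp]: "space \<mu> = {\<gamma>. is_ipath G \<gamma>}"
  using sets_eq_imp_space_eq[OF sets_path] by (simp add: space_path_space)

lemma sets_cylinder' [simp, intro]: "cylinder G p \<in> sets (path_space G)"
  by (rule sets_cylinder)

lemma finite_out: "finite (out_arcs G v)"
proof (cases "v \<in> verts G")
  case False
  then have "out_arcs G v = {}" by auto
  then show ?thesis by simp
qed (rule finite_out_arcs)

lemma AE_traverses: "AE \<gamma> in \<mu>. is_ipath G \<gamma> \<and> path_vert \<gamma> 0 = r \<and> inj (path_edge \<gamma>) \<and>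
    (\<forall>e \<in> arcs G. \<exists>i. path_edge \<gamma> i = e)"
proof -
  have "AE \<gamma> in \<mu>. path_vert \<gamma> 0 = r \<and> (\<forall>e \<in> arcs G. \<exists>!i. path_edge \<gamma> i = e)"
    using gibbs by (simp add: proper_gibbs_measure_def)
  moreover have "AE \<gamma> in \<mu>. is_ipath G \<gamma>" by (rule AE_I2) simp
  ultimately show ?thesis
  proof eventually_elim
    case (elim \<gamma>)
    then have "inj (path_edge \<gamma>)" by (intro injI) (metis is_ipath_def)
    then show ?case using elim by blast
  qed
qed

lemma subalgebra_future: "subalgebra \<mu> (future_algebra G n)"
proof -
  let ?f = "\<lambda>\<gamma> i. \<gamma> (n + i)" and ?P = "path_space G"
  have shift: "is_ipath G (?f \<gamma>)" if "is_ipath G \<gamma>" for \<gamma>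
    using that by (auto simp: is_ipath_def path_vert_def path_edge_def)
  have f: "?f \<in> space ?P \<rightarrow> space ?P" using shift by (auto simp: space_path_space)
  have "?f \<in> ?P \<rightarrow>\<^sub>M ?P"
  proof -
    have "?f \<in> ?P \<rightarrow>\<^sub>M Pi\<^sub>M UNIV (\<lambda>_. count_space (verts G \<times> arcs G))"
      using f by (intro measurable_PiM_single' measurable_path_entry)
        (auto simp: space_path_space is_ipath_def path_vert_def path_edge_def mem_Times_iff)
    then show ?thesis using shift
      by (subst (2) path_space_def, intro measurable_restrict_space2) (auto simp: space_path_space)
  qed
  then show ?thesis
    unfolding subalgebra_def future_algebra_def using f sets_eq_imp_space_eq[OF sets_path]
    by (auto simp: sets_vimage_algebra2 intro: measurable_sets)
qed

lemma prob_cylinder_cond_exp: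
  "prob (cylinder G p) = (\<integral>\<gamma>. real_cond_exp \<mu> (future_algebra G (length p))
      (indicator {\<gamma> \<in> space \<mu>. first_steps (length p) \<gamma> \<in> {p}}) \<gamma> \<partial>\<mu>)"
proof -
  interpret finite_measure_subalgebra \<mu> "future_algebra G (length p)"
    by unfold_locales (rule subalgebra_future)
  have "{\<gamma> \<in> space \<mu>. first_steps (length p) \<gamma> \<in> {p}} = cylinder G p" by (auto simp: cylinder_def)
  moreover have "cylinder G p \<inter> space \<mu> = cylinder G p" by (auto simp: cylinder_def)
  ultimately show ?thesis
    using real_cond_exp_int(2)[of "indicator (cylinder G p)"] by (simp add: emeasure_eq_measure)
qed

text \<open>
  Exchangeability is the form in which the Gibbs property enters the proof. The conditional law
  of the first \<open>n\<close> steps gives two Eulerian paths of the same arc set with the same endpoints equal weight,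
  whatever the future; hence their cylinders have conditional probabilities that agree almost
  surely, and it remains to integrate.
\<close>

theorem prob_cylinder_exchange:
  assumes p: "cas r p x" "distinct p" and q: "cas r q x" "distinct q" and eq: "set p = set q"
  shows "prob (cylinder G p) = prob (cylinder G q)"
proof -
  define n where "n = length p"
  have n: "length p = n" "length q = n" using p q eq by (auto simp: n_def) (metis distinct_card)
  let ?E = "\<lambda>p. real_cond_exp \<mu> (future_algebra G n)
      (indicator {\<gamma> \<in> space \<mu>. first_steps n \<gamma> \<in> {p}})"
  have law: "AE \<gamma> in \<mu>. ?E p \<gamma> = measure_pmf.prob (uniform_eulerian_path G r n \<gamma>) {p}" for p
    using gibbs unfolding proper_gibbs_measure_def by blast
  have "AE \<gamma> in \<mu>. ?E p \<gamma> = ?E q \<gamma>"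
    using law[of p] law[of q] AE_traverses
  proof eventually_elim
    case (elim \<gamma>)
    let ?S = "{p. eulerian_path (crossed_before G n \<gamma>) r p (path_vert \<gamma> n)}"
    have S: "?S = {p. cas r p (path_vert \<gamma> n) \<and> distinct p \<and> set p = path_edge \<gamma> ` {..<n}}"
      using eulerian_path_crossed_before[of G n \<gamma>] elim by auto
    have "finite ?S"
      unfolding S by (rule finite_subset[OF _ finite_subset_distinct[of "path_edge \<gamma> ` {..<n}"]]) auto
    moreover have "first_steps n \<gamma> \<in> ?S"
      unfolding S using elim cas_first_steps[of \<gamma> n]
      by (auto simp: set_first_steps first_steps_def distinct_map inj_on_def inj_def)
    moreover have "p \<in> ?S \<longleftrightarrow> q \<in> ?S"
      unfolding S using p q eq cas_unique by blast
    \<comment> \<open>Being finite and nonempty, \<open>?S\<close> carries a genuine uniform distribution.\<close>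
    ultimately show ?case
      using elim unfolding uniform_eulerian_path_def
      by (subst (asm) (1 2) measure_pmf_of_set) (auto split: if_splits)
  qed
  then have "integral\<^sup>L \<mu> (?E p) = integral\<^sup>L \<mu> (?E q)"
    by (intro integral_cong_AE) auto
  then show ?thesis using prob_cylinder_cond_exp[of p] prob_cylinder_cond_exp[of q] n by simp
qed

end

section \<open>The step after a given beginning\<close>

lemma cas_redirect_last:
  assumes "g \<notin> set p"
  shows "pre_digraph.cas (G\<lparr>head := (head G)(g := b)\<rparr>) u (p @ [g]) b \<longleftrightarrow>
         pre_digraph.cas G u (p @ [g]) (head G g)"
  using assms by (induction p arbitrary: u) (auto simp: pre_digraph.cas.simps)

primrec reach :: "('a, 'b) pre_digraph \<Rightarrow> 'a \<Rightarrow> nat \<Rightarrow> 'a set" where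
  "reach G r 0 = {r}"
| "reach G r (Suc n) = reach G r n \<union> head G ` (\<Union>v\<in>reach G r n. out_arcs G v)"

definition walks :: "('a, 'b) pre_digraph \<Rightarrow> 'a \<Rightarrow> nat \<Rightarrow> 'b list set" where
  "walks G r n = {p. length p = n \<and> distinct p \<and> set p \<subseteq> arcs G \<and> (\<exists>x. pre_digraph.cas G r p x)}"

context gibbs_measure
begin

lemma finite_reach: "finite (reach G r n)"
  by (induction n) (auto simp: finite_out)

lemma reach_mono: "m \<le> n \<Longrightarrow> reach G r m \<subseteq> reach G r n"
  by (rule lift_Suc_mono_le[of "reach G r"]) auto

lemma cas_reach:
  "cas r p x \<Longrightarrow> set p \<subseteq> arcs G \<Longrightarrow>
     x \<in> reach G r (length p) \<and> set p \<subseteq> (\<Union>v\<in>reach G r (length p). out_arcs G v)"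
proof (induction p arbitrary: x rule: rev_induct)
  case (snoc e p)
  then obtain y where "cas r p y" "tail G e = y" "head G e = x"
    by (auto simp: cas_append_ex simp del: cas_append_iff)
  with snoc show ?case by fastforce
qed simp

lemma path_vert_reach:
  assumes "is_ipath G \<gamma>" "path_vert \<gamma> 0 = r" "i \<le> J"
  shows "path_vert \<gamma> i \<in> reach G r J"
proof -
  have "path_vert \<gamma> i \<in> reach G r i"
    using cas_reach[of "first_steps i \<gamma>" "path_vert \<gamma> i"] cas_first_steps[of \<gamma> i] assms
    by (auto simp: set_first_steps is_ipath_def)
  then show ?thesis using reach_mono[OF assms(3)] by blast
qed

lemma finite_walks: "finite (walks G r n)"
proof (rule finite_subset)
  show "walks G r n \<subseteq> {p. set p \<subseteq> (\<Union>v\<in>reach G r n. out_arcs G v) \<and> length p = n}"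
    using cas_reach unfolding walks_def by blast
qed (intro finite_lists_length_eq finite_UN_I finite_reach finite_out)

lemma first_steps_walks:
  assumes "is_ipath G \<gamma>" "path_vert \<gamma> 0 = r" "inj (path_edge \<gamma>)"
  shows "first_steps n \<gamma> \<in> walks G r n"
  using cas_first_steps[of \<gamma> n] assms
  by (auto simp: walks_def set_first_steps is_ipath_def first_steps_def distinct_map inj_on_def inj_def)

lemma sets_first_steps: "{\<gamma>. is_ipath G \<gamma> \<and> Q (first_steps n \<gamma>)} \<in> sets (path_space G)"
proof -
  have "first_steps n -` {p. Q p} \<inter> space (path_space G) \<in> sets (path_space G)"
    by (rule measurable_sets[OF measurable_first_steps[OF countable_arcs]]) simp
  then show ?thesis by (simp add: space_path_space vimage_def Int_def conj_commute)
qed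

lemma prob_first_steps:
  "prob {\<gamma>. is_ipath G \<gamma> \<and> Q (first_steps n \<gamma>)} = (\<Sum>p | p \<in> walks G r n \<and> Q p. prob (cylinder G p))"
proof -
  have fin: "finite {p. p \<in> walks G r n \<and> Q p}" by (simp add: finite_walks)
  have U: "(\<Union>p\<in>{p. p \<in> walks G r n \<and> Q p}. cylinder G p) =
      {\<gamma>. is_ipath G \<gamma> \<and> first_steps n \<gamma> \<in> walks G r n \<and> Q (first_steps n \<gamma>)}"
    by (auto simp: cylinder_def walks_def)
  have "prob {\<gamma>. is_ipath G \<gamma> \<and> Q (first_steps n \<gamma>)} =
      prob {\<gamma>. is_ipath G \<gamma> \<and> first_steps n \<gamma> \<in> walks G r n \<and> Q (first_steps n \<gamma>)}"
  proof (rule measure_eq_AE)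
    show "AE \<gamma> in \<mu>. \<gamma> \<in> {\<gamma>. is_ipath G \<gamma> \<and> Q (first_steps n \<gamma>)} \<longleftrightarrow>
       \<gamma> \<in> {\<gamma>. is_ipath G \<gamma> \<and> first_steps n \<gamma> \<in> walks G r n \<and> Q (first_steps n \<gamma>)}"
      using AE_traverses by eventually_elim (use first_steps_walks in blast)
  qed (use sets_first_steps[of "\<lambda>p. p \<in> walks G r n \<and> Q p"] in \<open>simp_all add: sets_first_steps\<close>)
  also have "\<dots> = (\<Sum>p | p \<in> walks G r n \<and> Q p. prob (cylinder G p))"
    unfolding U[symmetric] using fin
    by (intro finite_measure_finite_Union)
       (auto simp: disjoint_family_on_def walks_def, simp add: cylinder_def)
  finally show ?thesis .
qed

end

text \<open>
  A beginning \<open>q\<close> of the path ends at \<open>a\<close>, and the question is how likely \<open>e\<close> is as the next step.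
  The potential \<open>\<phi>\<close> belongs to the graph without the arcs of \<open>q\<close>; it vanishes at \<open>a\<close> and equals \<open>1\<close>
  outside \<open>B\<close>.
\<close>

locale gibbs_continuation = gibbs_measure G \<mu> r
  for G :: "('a, 'b) pre_digraph" and \<mu> :: "('a, 'b) ipath measure" and r :: 'a +
  fixes q :: "'b list" and a :: 'a and B :: "'a set" and \<phi> :: "'a \<Rightarrow> real" and e :: 'b
  assumes q: "cas r q a" "distinct q" "set q \<subseteq> arcs G"
    and a: "a \<in> B"
    and \<phi>: "\<phi> a = 0" "\<And>v. v \<notin> B \<Longrightarrow> \<phi> v = 1" "\<And>v. \<phi> v \<le> 1"
      "\<And>v. v \<in> B \<Longrightarrow> v \<noteq> a \<Longrightarrow> (\<Sum>f\<in>out_arcs G v - set q. \<phi> v - \<phi> (head G f)) = 0"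
    and e: "e \<in> out_arcs G a - set q"
begin

definition out_potential :: real where
  "out_potential = (\<Sum>f\<in>out_arcs G a - set q. \<phi> (head G f))"

text \<open>
  Continuations that have used up all out-arcs of the vertices of \<open>B\<close> before their last step, which
  thus starts outside \<open>B\<close>. At the vertices of \<open>B\<close>, the arcs of such a continuation are all the out-arcs of the
  graph that \<open>q\<close> has left over, so that \<open>\<phi>\<close> is harmonic for them.
\<close>

definition cover :: "nat \<Rightarrow> 'b list set" where
  "cover n = {P. q @ P \<in> walks G r (length q + Suc n) \<and>
                 (\<forall>v\<in>B. out_arcs G v \<subseteq> set q \<union> set (butlast P))}"

definition early_exit :: "'b list \<Rightarrow> bool" where
  "early_exit P \<longleftrightarrow> (\<exists>A C f h. P = A @ C \<and> f \<in> set A \<and> h \<in> set C \<and> tail G f \<notin> B \<and> tail G h = a)"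

text \<open>
  Its weighted sum over a class of continuations vanishes exactly if, in that class, the last exit
  from \<open>a\<close> uses \<open>e\<close> with probability \<open>\<phi> (head G e) / out_potential\<close>.
\<close>

abbreviation (input) first_step_error :: "'b list \<Rightarrow> real" where
  "first_step_error P \<equiv> out_potential * (1 - real (card (out_arcs G a - set q) - 1) * of_bool (hd P = e)) - \<phi> (head G e)"

lemma finite_cover: "finite (cover n)"
  by (rule finite_subset[OF _ finite_vimageI[OF finite_walks[of "length q + Suc n"], of "(@) q"]])
     (auto simp: cover_def inj_on_def)

text \<open>
  The continuations with a given arc set and a given last arc \<open>g\<close> all have the same probability,
  by exchangeability, and they are the closed trails of the graph in which \<open>g\<close> is redirected to
  \<open>a\<close>. So the estimate for uniform closed trails applies.
\<close>

lemma fibre_estimate: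
  assumes P0: "P0 \<in> cover n"
  defines "F \<equiv> {P \<in> cover n. (set P, last P) = (set P0, last P0)}"
  shows "\<bar>\<Sum>P\<in>F. prob (cylinder G (q @ P)) * first_step_error P\<bar> \<le>
         out_potential * (\<Sum>P | P \<in> F \<and> early_exit P. prob (cylinder G (q @ P)))"
    and "1 \<le> out_potential"
proof -
  define R where "R = set P0"
  define g where "g = last P0"
  define G' where "G' = G\<lparr>head := (head G)(g := a)\<rparr>"
  define U where "U = pre_digraph.closed_trails G' a R g"
  have [simp]: "tail G' = tail G" by (simp add: G'_def)
  have P0': "P0 \<noteq> []" "length P0 = Suc n" "distinct (q @ P0)" "set P0 \<subseteq> arcs G"
    using P0 by (auto simp: cover_def walks_def)
  have covered: "\<And>v. v \<in> B \<Longrightarrow> out_arcs G v \<subseteq> set q \<union> set (butlast P0)"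
    using P0 by (auto simp: cover_def)
  have g: "g \<in> R" using P0' by (auto simp: g_def R_def)
  have g_new: "g \<notin> set q \<union> set (butlast P0)"
    using P0' append_butlast_last_id[OF P0'(1)] unfolding g_def
    by (metis UnE disjoint_iff distinct_append last_in_set list.set_intros(1) not_distinct_conv_prefix butlast_snoc in_set_conv_decomp)
  have gB: "tail G g \<notin> B"
  proof
    assume "tail G g \<in> B"
    moreover have "g \<in> out_arcs G (tail G g)" using g P0'(4) by (auto simp: R_def)
    ultimately show False using covered g_new by blast
  qed
  have head': "head G' f = head G f" if "tail G f \<in> B" for f using that gB by (auto simp: G'_def)
  have butlastR: "set (butlast P0) \<subseteq> R" using in_set_butlastD by (auto simp: R_def)
  have out_R: "{f \<in> R. tail G f = v} = out_arcs G v - set q" if "v \<in> B" for v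
    using covered[OF that] P0'(3,4) butlastR by (auto simp: R_def)
  have mem_F: "P \<in> F \<longleftrightarrow> cas a P (head G g) \<and> distinct P \<and> set P = R \<and> P \<noteq> [] \<and> last P = g" for P
  proof
    assume P: "cas a P (head G g) \<and> distinct P \<and> set P = R \<and> P \<noteq> [] \<and> last P = g"
    then have "length P = Suc n" using P0' R_def by (metis distinct_append distinct_card)
    moreover have "set (butlast P) = set (butlast P0)"
    proof -
      have *: "set (butlast P) = R - {g}" if P: "distinct P" "set P = R" "P \<noteq> []" "last P = g" for P
      proof -
        obtain P' where P': "P = P' @ [g]" using P(3,4) append_butlast_last_id by metis
        have "g \<notin> set P'" "set P = insert g (set P')" using P(1) unfolding P' by simp_all
        then show ?thesis using P(2) P' by auto
      qed
      show ?thesis using *[of P] *[of P0] P P0' by (simp add: R_def g_def)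
    qed
    moreover have "cas r (q @ P) (head G g)" using q(1) P cas_append_ex by blast
    ultimately show "P \<in> F"
      using P P0' q covered by (auto simp: F_def cover_def walks_def R_def g_def simp del: cas_append_iff)
  next
    assume P: "P \<in> F"
    then have "distinct P" "P \<noteq> []" "\<exists>x. cas r (q @ P) x"
      by (auto simp: F_def cover_def walks_def simp del: cas_append_iff)
    then obtain x y where x: "cas r q y" "cas y P x" "distinct P" "P \<noteq> []"
      unfolding cas_append_ex by blast
    then have "cas a P x" using cas_unique[OF q(1)] by blast
    moreover have "last P = g" using P by (simp add: F_def g_def)
    then have "P = butlast P @ [g]" using x(4) append_butlast_last_id by metis
    then have "x = head G g" using x(2) cas_append_ex[of y "butlast P" "[g]" x] by force
    ultimately show "cas a P (head G g) \<and> distinct P \<and> set P = R \<and> P \<noteq> [] \<and> last P = g"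
      using P x by (auto simp: F_def R_def g_def)
  qed
  have FU: "F = U"
  proof -
    have "pre_digraph.cas G' a P a \<longleftrightarrow> cas a P (head G g)" if "distinct P" "P \<noteq> []" "last P = g" for P
    proof -
      have P: "P = butlast P @ [g]" using that(2,3) append_butlast_last_id by metis
      then have "g \<notin> set (butlast P)" using that(1) by (metis distinct_append not_distinct_conv_prefix distinct_butlast)
      then show ?thesis using cas_redirect_last[of g "butlast P" G a a] P unfolding G'_def by metis
    qed
    then show ?thesis by (auto simp: mem_F U_def pre_digraph.closed_trails_def)
  qed
  define w where "w = prob (cylinder G (q @ P0))"
  have const: "prob (cylinder G (q @ P)) = w" if "P \<in> F" for P
  proof -
    have "P0 \<in> F" using P0 by (simp add: F_def)
    have *: "cas r (q @ P) (head G g) \<and> distinct (q @ P) \<and> set (q @ P) = set q \<union> R" if "P \<in> F" for P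
      using that[unfolded mem_F] q P0' cas_append_ex[of r q P "head G g"] by (auto simp: R_def)
    show ?thesis unfolding w_def
      using *[OF that] *[OF \<open>P0 \<in> F\<close>] by (intro prob_cylinder_exchange) auto
  qed
  have out_a: "out_potential = (\<Sum>f | f \<in> R \<and> tail G f = a. \<phi> (head G' f))"
    unfolding out_potential_def out_R[OF a] using gB a by (intro sum.cong) (auto simp: head')
  have harm: "(\<Sum>f | f \<in> R \<and> tail G' f = v. \<phi> v - \<phi> (head G' f)) = 0" if "v \<in> B" "v \<noteq> a" for v
  proof -
    have "(\<Sum>f | f \<in> R \<and> tail G' f = v. \<phi> v - \<phi> (head G' f)) =
        (\<Sum>f\<in>out_arcs G v - set q. \<phi> v - \<phi> (head G f))"
      using gB that(1) out_R[OF that(1)] by (intro sum.cong) (auto simp: head')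
    then show ?thesis using \<phi>(4)[OF that] by simp
  qed
  have "e \<in> {f \<in> R. tail G f = a}" unfolding out_R[OF a] by (rule e)
  then have eR: "e \<in> R" "tail G' e = a" by simp_all
  have head_e: "head G' e = head G e" using eR(2) a by (intro head') simp
  have finR: "finite R" by (simp add: R_def)
  have tail': "tail G' = tail G" and gB': "tail G' g \<notin> B" and head_g: "head G' g = a"
    using gB by (simp_all add: G'_def)
  define D where "D = {P \<in> U. \<exists>f\<in>R. tail G f \<notin> B \<and>
      pre_digraph.origin G' a f P \<noteq> pre_digraph.origin G' a g P}"
  have est: "\<bar>out_potential * (card U - real (card (out_arcs G a - set q) - 1) * card {P \<in> U. hd P = e})
      - \<phi> (head G e) * card U\<bar> \<le> out_potential * card D"
    unfolding out_a D_def U_def out_R[OF a, symmetric] head_e[symmetric] tail'[symmetric]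
    by (rule pre_digraph.first_step_estimate(1)) (fact finR eR g gB' a \<phi> harm)+
  have "U \<noteq> {}" using FU P0 by (auto simp: F_def)
  then show ge: "1 \<le> out_potential"
    unfolding out_a U_def tail'[symmetric]
    by (rule pre_digraph.first_step_estimate(2)[rotated -2]) (fact finR eR g gB' a \<phi> harm head_g)+
  have finU: "finite U" using FU finite_subset[OF _ finite_cover[of n], of F] by (auto simp: F_def)
  have early: "D \<subseteq> {P \<in> F. early_exit P}"
  proof
    fix P assume "P \<in> D"
    then obtain f where f: "P \<in> U" "f \<in> R" "tail G' f \<notin> B"
        "pre_digraph.origin G' a f P \<noteq> pre_digraph.origin G' a g P"
      by (auto simp: D_def)
    moreover have "tail G' g \<noteq> a" "tail G' f \<noteq> a" using a gB' f(3) by auto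
    ultimately obtain A C h where "P = A @ C" "f \<in> set A" "h \<in> set C" "tail G' h = a"
      using pre_digraph.origin_neq_last[of P G' a R g f] unfolding U_def by metis
    then have "early_exit P" using f(3) unfolding early_exit_def tail' by blast
    then show "P \<in> {P \<in> F. early_exit P}" using f(1) FU by simp
  qed
  have w0: "0 \<le> w" by (simp add: w_def)
  have "(\<Sum>P\<in>F. prob (cylinder G (q @ P)) * first_step_error P) = (\<Sum>P\<in>U. w * first_step_error P)"
    using const FU by (intro sum.cong) auto
  also have "\<dots> = w * (out_potential * (card U - real (card (out_arcs G a - set q) - 1) * card {P \<in> U. hd P = e})
      - \<phi> (head G e) * card U)"
  proof -
    have "(\<Sum>P\<in>U. of_bool (hd P = e)) = real (card {P \<in> U. hd P = e})"
      using finU by (simp add: of_bool_def sum.If_cases Int_def)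
    moreover have "(\<Sum>P\<in>U. first_step_error P) = (\<Sum>P\<in>U. (out_potential - \<phi> (head G e)) -
        out_potential * real (card (out_arcs G a - set q) - 1) * of_bool (hd P = e))"
      by (intro sum.cong) (simp_all add: algebra_simps)
    ultimately show ?thesis
      unfolding sum_distrib_left[symmetric] sum_subtractf by (simp add: algebra_simps)
  qed
  also have "\<bar>\<dots>\<bar> \<le> w * (out_potential * card D)"
    using est w0 by (simp add: abs_mult mult_left_mono)
  also have "\<dots> = out_potential * (\<Sum>P\<in>D. w)" by simp
  also have "\<dots> \<le> out_potential * (\<Sum>P | P \<in> F \<and> early_exit P. w)"
    using early ge w0 finU FU by (intro mult_left_mono sum_mono2) auto
  also have "(\<Sum>P | P \<in> F \<and> early_exit P. w) = (\<Sum>P | P \<in> F \<and> early_exit P. prob (cylinder G (q @ P)))"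
    using const by (intro sum.cong) auto
  finally show "\<bar>\<Sum>P\<in>F. prob (cylinder G (q @ P)) * first_step_error P\<bar> \<le>
         out_potential * (\<Sum>P | P \<in> F \<and> early_exit P. prob (cylinder G (q @ P)))" .
qed

end

section \<open>Passing to the limit\<close>

context gibbs_measure
begin

lemma prob_cylinder_nonzero:
  assumes "prob (cylinder G p) \<noteq> 0"
  shows "p \<in> walks G r (length p)"
proof (rule ccontr)
  assume no: "p \<notin> walks G r (length p)"
  have "AE \<gamma> in \<mu>. \<gamma> \<notin> cylinder G p"
    using AE_traverses
  proof eventually_elim
    case (elim \<gamma>)
    then have "first_steps (length p) \<gamma> \<in> walks G r (length p)" by (intro first_steps_walks) auto
    then show ?case using no by (auto simp: cylinder_def)
  qed
  then have "prob (cylinder G p) = 0" by (subst prob_eq_0) auto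
  then show False using assms by simp
qed

lemma prob_cylinder_snoc_le: "prob (cylinder G (q @ [e])) \<le> prob (cylinder G q)"
proof (rule finite_measure_mono)
  show "cylinder G (q @ [e]) \<subseteq> cylinder G q" by (auto simp: cylinder_def first_steps_Suc)
qed simp

lemma prob_cylinder_forced:
  assumes "cas r q a" "out_arcs G a - set q = {e}"
  shows "prob (cylinder G (q @ [e])) = prob (cylinder G q)"
proof (rule measure_eq_AE)
  show "AE \<gamma> in \<mu>. \<gamma> \<in> cylinder G (q @ [e]) \<longleftrightarrow> \<gamma> \<in> cylinder G q"
    using AE_traverses
  proof eventually_elim
    case (elim \<gamma>)
    have "path_edge \<gamma> (length q) = e" if "first_steps (length q) \<gamma> = q"
    proof -
      have "path_vert \<gamma> (length q) = a"
        using cas_first_steps[of \<gamma> "length q"] elim that assms(1) cas_unique by auto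
      moreover have "path_edge \<gamma> (length q) \<notin> set q"
        using elim set_first_steps[of "length q" \<gamma>] that by (auto dest: injD)
      ultimately have "path_edge \<gamma> (length q) \<in> out_arcs G a - set q"
        using elim by (auto simp: is_ipath_def)
      then show ?thesis using assms(2) by simp
    qed
    then show ?case by (auto simp: cylinder_def first_steps_Suc)
  qed
qed simp_all

definition late_visit :: "'a \<Rightarrow> nat \<Rightarrow> ('a, 'b) ipath set" where
  "late_visit a J = {\<gamma>. is_ipath G \<gamma> \<and> (\<exists>j>J. path_vert \<gamma> j = a)}"

lemma sets_late_visit: "late_visit a J \<in> sets (path_space G)"
proof -
  have "late_visit a J = (\<Union>j\<in>{J<..}. {\<gamma>. is_ipath G \<gamma> \<and> tail G (last (first_steps (Suc j) \<gamma>)) = a})"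
    by (auto simp: late_visit_def first_steps_Suc is_ipath_def)
  then show ?thesis
    using sets_first_steps[of "\<lambda>p. tail G (last p) = a"] by (auto intro!: sets.countable_UN')
qed

text \<open>
  Here it matters that the path is a single half-infinite one that uses each arc once: it
  visits \<open>a\<close> finitely often only.
\<close>

lemma prob_late_visit_tendsto_0: "(\<lambda>J. prob (late_visit a J)) \<longlonglongrightarrow> 0"
proof -
  have "(\<lambda>J. prob (late_visit a J)) \<longlonglongrightarrow> prob (\<Inter>J. late_visit a J)"
  proof (rule finite_Lim_measure_decseq)
    show "decseq (late_visit a)" by (auto simp: decseq_def late_visit_def intro: le_less_trans)
  qed (auto simp: sets_late_visit)
  also have "prob (\<Inter>J. late_visit a J) = 0"
  proof (subst prob_eq_0)
    show "(\<Inter>J. late_visit a J) \<in> events" by (auto simp: sets_late_visit)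
    show "AE \<gamma> in \<mu>. \<gamma> \<notin> (\<Inter>J. late_visit a J)"
      using AE_traverses
    proof eventually_elim
      case (elim \<gamma>)
      have "{j. path_vert \<gamma> j = a} \<subseteq> path_edge \<gamma> -` out_arcs G a"
        using elim by (auto simp: is_ipath_def)
      then have "finite {j. path_vert \<gamma> j = a}"
        using finite_vimageI[OF finite_out[of a], of "path_edge \<gamma>"] elim finite_subset by blast
      then obtain J where "\<forall>j\<in>{j. path_vert \<gamma> j = a}. j \<le> J"
        using finite_nat_set_iff_bounded_le by auto
      then have "\<gamma> \<notin> late_visit a J" by (auto simp: late_visit_def)
      then show ?case by blast
    qed
  qed
  finally show ?thesis .
qed

lemma prob_covered_tendsto:
  assumes "finite B" and X: "X \<in> sets (path_space G)"
  shows "(\<lambda>n. prob (X \<inter> {\<gamma>. \<forall>v\<in>B. out_arcs G v \<subseteq> path_edge \<gamma> ` {..<k + n}})) \<longlonglongrightarrow> prob X"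
proof -
  let ?A = "\<lambda>n. X \<inter> {\<gamma>. \<forall>v\<in>B. out_arcs G v \<subseteq> path_edge \<gamma> ` {..<k + n}}"
  have XS: "X \<subseteq> {\<gamma>. is_ipath G \<gamma>}" using sets.sets_into_space[OF X] by (simp add: space_path_space)
  have A: "?A n \<in> sets (path_space G)" for n
  proof -
    have "?A n = X \<inter> {\<gamma>. is_ipath G \<gamma> \<and> (\<forall>v\<in>B. out_arcs G v \<subseteq> set (first_steps (k + n) \<gamma>))}"
      using XS by (auto simp: set_first_steps)
    then show ?thesis using X sets_first_steps[of "\<lambda>p. \<forall>v\<in>B. out_arcs G v \<subseteq> set p"] by simp
  qed
  have "(\<lambda>n. prob (?A n)) \<longlonglongrightarrow> prob (\<Union>n. ?A n)"
  proof (rule finite_Lim_measure_incseq)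
    show "range ?A \<subseteq> events" using A by auto
    have "path_edge \<gamma> ` {..<k + m} \<subseteq> path_edge \<gamma> ` {..<k + n}" if "m \<le> n" for m n and \<gamma> :: "('a, 'b) ipath"
      using that by (intro image_mono) auto
    then show "incseq ?A" unfolding incseq_def by blast
  qed
  also have "prob (\<Union>n. ?A n) = prob X"
  proof (rule measure_eq_AE)
    show "AE \<gamma> in \<mu>. \<gamma> \<in> (\<Union>n. ?A n) \<longleftrightarrow> \<gamma> \<in> X"
      using AE_traverses
    proof eventually_elim
      case (elim \<gamma>)
      let ?F = "\<Union>v\<in>B. out_arcs G v"
      have "?F \<subseteq> range (path_edge \<gamma>)" using elim by (auto 4 4 simp: image_iff)
      moreover have "finite ?F" using assms(1) finite_out by simp
      ultimately obtain N where N: "finite N" "?F = path_edge \<gamma> ` N"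
        by (meson finite_subset_image)
      then obtain n where "N \<subseteq> {..<n}" by (metis finite_nat_iff_bounded)
      then have "?F \<subseteq> path_edge \<gamma> ` {..<k + n}" unfolding N by (intro image_mono) auto
      then show ?case by blast
    qed
    show "(\<Union>n. ?A n) \<in> events" by (rule sets.countable_UN) (use A in auto)
    show "X \<in> events" using X by simp
  qed
  finally show ?thesis .
qed

end

context gibbs_continuation
begin

lemma cover_estimate:
  "\<bar>\<Sum>P\<in>cover n. prob (cylinder G (q @ P)) * first_step_error P\<bar> \<le>
     out_potential * (\<Sum>P | P \<in> cover n \<and> early_exit P. prob (cylinder G (q @ P)))"
proof -
  let ?key = "\<lambda>P. (set P, last P)" and ?w = "\<lambda>P. prob (cylinder G (q @ P))"
  have fin: "finite (cover n)" by (rule finite_cover)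
  have "(\<Sum>P\<in>cover n. ?w P * first_step_error P) =
      (\<Sum>y\<in>?key ` cover n. \<Sum>P | P \<in> cover n \<and> ?key P = y. ?w P * first_step_error P)"
    using fin by (intro sum.group[symmetric]) auto
  also have "\<bar>\<dots>\<bar> \<le> (\<Sum>y\<in>?key ` cover n. \<bar>\<Sum>P | P \<in> cover n \<and> ?key P = y. ?w P * first_step_error P\<bar>)"
    by (rule sum_abs)
  also have "\<dots> \<le> (\<Sum>y\<in>?key ` cover n. out_potential *
      (\<Sum>P | P \<in> {P \<in> cover n. early_exit P} \<and> ?key P = y. ?w P))"
  proof (rule sum_mono)
    fix y assume "y \<in> ?key ` cover n"
    then obtain P0 where P0: "P0 \<in> cover n" "y = ?key P0" by blast
    have "{P. P \<in> {P \<in> cover n. early_exit P} \<and> ?key P = y} =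
        {P. P \<in> {P \<in> cover n. ?key P = ?key P0} \<and> early_exit P}" using P0(2) by auto
    then show "\<bar>\<Sum>P | P \<in> cover n \<and> ?key P = y. ?w P * first_step_error P\<bar> \<le> out_potential *
      (\<Sum>P | P \<in> {P \<in> cover n. early_exit P} \<and> ?key P = y. ?w P)"
      using fibre_estimate(1)[OF P0(1)] P0(2) by simp
  qed
  also have "\<dots> = out_potential * (\<Sum>P\<in>{P \<in> cover n. early_exit P}. ?w P)"
    unfolding sum_distrib_left[symmetric] using fin
    by (intro arg_cong[where f = "\<lambda>x. out_potential * x"] sum.group) auto
  finally show ?thesis by simp
qed

definition covered :: "nat \<Rightarrow> ('a, 'b) ipath set" where
  "covered n = {\<gamma>. \<forall>v\<in>B. out_arcs G v \<subseteq> path_edge \<gamma> ` {..<length q + n}}"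

lemma prob_cover:
  "(\<Sum>P | P \<in> cover n \<and> Q P. prob (cylinder G (q @ P))) =
   prob ({\<gamma> \<in> cylinder G q. Q (drop (length q) (first_steps (length q + Suc n) \<gamma>))} \<inter> covered n)"
proof -
  let ?m = "length q + Suc n"
  define Q' where "Q' p \<longleftrightarrow> take (length q) p = q \<and> drop (length q) p \<in> cover n \<and> Q (drop (length q) p)" for p
  have "prob ({\<gamma> \<in> cylinder G q. Q (drop (length q) (first_steps ?m \<gamma>))} \<inter> covered n) =
      prob {\<gamma>. is_ipath G \<gamma> \<and> Q' (first_steps ?m \<gamma>)}"
  proof (rule measure_eq_AE)
    show "AE \<gamma> in \<mu>. \<gamma> \<in> {\<gamma> \<in> cylinder G q. Q (drop (length q) (first_steps ?m \<gamma>))} \<inter> covered n \<longleftrightarrow>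
        \<gamma> \<in> {\<gamma>. is_ipath G \<gamma> \<and> Q' (first_steps ?m \<gamma>)}"
      using AE_traverses
    proof eventually_elim
      case (elim \<gamma>)
      have walk: "first_steps ?m \<gamma> \<in> walks G r ?m" using elim by (intro first_steps_walks) auto
      have take_q: "take (length q) (first_steps ?m \<gamma>) = first_steps (length q) \<gamma>"
        by (simp add: take_first_steps)
      let ?P = "drop (length q) (first_steps ?m \<gamma>)"
      have cross: "set q \<union> set (butlast ?P) = path_edge \<gamma> ` {..<length q + n}" if "first_steps (length q) \<gamma> = q"
      proof -
        have "first_steps (length q + n) \<gamma> = butlast (first_steps ?m \<gamma>)" by (simp add: first_steps_Suc)
        also have "\<dots> = butlast (q @ ?P)" using take_q that by (metis append_take_drop_id)
        also have "\<dots> = q @ butlast ?P" by (simp add: butlast_append)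
        finally show ?thesis by (metis set_append set_first_steps)
      qed
      have split: "q @ ?P = first_steps ?m \<gamma>" if "first_steps (length q) \<gamma> = q"
        using take_q that by (metis append_take_drop_id)
      show ?case
      proof (cases "first_steps (length q) \<gamma> = q")
        case True
        then show ?thesis using walk take_q elim
          unfolding Q'_def cover_def cylinder_def covered_def mem_Collect_eq Int_iff cross[OF True] split[OF True]
          by metis
      next
        case False
        then show ?thesis using take_q by (simp add: Q'_def cylinder_def)
      qed
    qed
    show "{\<gamma>. is_ipath G \<gamma> \<and> Q' (first_steps ?m \<gamma>)} \<in> events" by (simp add: sets_first_steps)
    have "{\<gamma> \<in> cylinder G q. Q (drop (length q) (first_steps ?m \<gamma>))} \<inter> covered n =
        {\<gamma>. is_ipath G \<gamma> \<and> take (length q) (first_steps ?m \<gamma>) = q \<and>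
            Q (drop (length q) (first_steps ?m \<gamma>)) \<and>
            (\<forall>v\<in>B. out_arcs G v \<subseteq> set (butlast (first_steps ?m \<gamma>)))}"
      by (auto simp: cylinder_def take_first_steps covered_def first_steps_Suc set_first_steps)
    then show "{\<gamma> \<in> cylinder G q. Q (drop (length q) (first_steps ?m \<gamma>))} \<inter> covered n \<in> events"
      using sets_first_steps[of "\<lambda>p. take (length q) p = q \<and> Q (drop (length q) p) \<and>
        (\<forall>v\<in>B. out_arcs G v \<subseteq> set (butlast p))"] by simp
  qed
  also have "\<dots> = (\<Sum>p | p \<in> walks G r ?m \<and> Q' p. prob (cylinder G p))" by (rule prob_first_steps)
  also have "{p. p \<in> walks G r ?m \<and> Q' p} = (@) q ` {P. P \<in> cover n \<and> Q P}"
  proof (intro equalityI subsetI)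
    fix p assume p: "p \<in> {p. p \<in> walks G r ?m \<and> Q' p}"
    then have "p = q @ drop (length q) p" by (metis (mono_tags) Q'_def append_take_drop_id mem_Collect_eq)
    then show "p \<in> (@) q ` {P. P \<in> cover n \<and> Q P}" using p by (auto simp: Q'_def)
  next
    fix p assume "p \<in> (@) q ` {P. P \<in> cover n \<and> Q P}"
    then obtain P where P: "p = q @ P" "P \<in> cover n" "Q P" by blast
    moreover have "q @ P \<in> walks G r ?m" using P(2) unfolding cover_def by blast
    ultimately show "p \<in> {p. p \<in> walks G r ?m \<and> Q' p}" by (simp add: Q'_def)
  qed
  also have "(\<Sum>p\<in>(@) q ` {P. P \<in> cover n \<and> Q P}. prob (cylinder G p)) =
      (\<Sum>P | P \<in> cover n \<and> Q P. prob (cylinder G (q @ P)))"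
    by (subst sum.reindex) (auto simp: inj_on_def)
  finally show ?thesis by (rule sym)
qed

text \<open>
  A path is in \<open>B\<close> for its first \<open>J\<close> steps, so a return to \<open>a\<close> after leaving \<open>B\<close> happens late.
\<close>

lemma prob_early_exit_le:
  assumes "reach G r J \<subseteq> B"
  shows "(\<Sum>P | P \<in> cover n \<and> early_exit P. prob (cylinder G (q @ P))) \<le> prob (late_visit a J)"
  unfolding prob_cover
proof (rule finite_measure_mono_AE)
  show "AE \<gamma> in \<mu>. \<gamma> \<in> {\<gamma> \<in> cylinder G q. early_exit (drop (length q) (first_steps (length q + Suc n) \<gamma>))}
      \<inter> covered n \<longrightarrow> \<gamma> \<in> late_visit a J"
    using AE_traverses
  proof eventually_elim
    case (elim \<gamma>)
    show ?case
    proof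
      assume "\<gamma> \<in> {\<gamma> \<in> cylinder G q. early_exit (drop (length q) (first_steps (length q + Suc n) \<gamma>))} \<inter> covered n"
      then obtain A C f h where P: "drop (length q) (first_steps (length q + Suc n) \<gamma>) = A @ C"
          "f \<in> set A" "h \<in> set C" "tail G f \<notin> B" "tail G h = a"
        by (auto simp: early_exit_def)
      obtain i where i: "i < length A" "f = A ! i" using P(2) by (metis in_set_conv_nth)
      obtain j where j: "j < length C" "h = C ! j" using P(3) by (metis in_set_conv_nth)
      have len: "length A + length C = Suc n" using arg_cong[OF P(1), of length] by simp
      have entry: "path_edge \<gamma> (length q + l) = (A @ C) ! l" if "l < Suc n" for l
        using that by (subst P(1)[symmetric]) simp
      have "f = path_edge \<gamma> (length q + i)" "h = path_edge \<gamma> (length q + (length A + j))"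
        using i j len entry[of i] entry[of "length A + j"] by (simp_all add: nth_append)
      then have v: "path_vert \<gamma> (length q + i) \<notin> B" "path_vert \<gamma> (length q + (length A + j)) = a"
        using P(4,5) elim by (auto simp: is_ipath_def)
      then have "J < length q + i" using path_vert_reach[of \<gamma> "length q + i" J] elim assms by fastforce
      then show "\<gamma> \<in> late_visit a J"
        using v(2) i elim by (auto simp: late_visit_def intro!: exI[of _ "length q + (length A + j)"])
    qed
  qed
qed (simp add: sets_late_visit)

text \<open>
  The limit \<open>n \<rightarrow> \<infinity>\<close> of the estimates for the coverings. The bound involves \<open>\<mu>\<close> only through the
  late visits to \<open>a\<close>, while \<open>\<phi>\<close> is the same for all Gibbs measures.
\<close>

theorem continuation_estimate:
  assumes B: "finite B" "reach G r J \<subseteq> B" and nonzero: "prob (cylinder G q) \<noteq> 0"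
  shows "\<bar>(out_potential - \<phi> (head G e)) * prob (cylinder G q) -
           out_potential * real (card (out_arcs G a - set q) - 1) * prob (cylinder G (q @ [e]))\<bar>
         \<le> out_potential * prob (late_visit a J)"
    and "1 \<le> out_potential"
proof -
  let ?x = "\<lambda>n. prob (cylinder G q \<inter> covered n)" and ?y = "\<lambda>n. prob (cylinder G (q @ [e]) \<inter> covered n)"
  let ?c = "real (card (out_arcs G a - set q) - 1)"
  have x: "?x \<longlonglongrightarrow> prob (cylinder G q)" and y: "?y \<longlonglongrightarrow> prob (cylinder G (q @ [e]))"
    unfolding covered_def by (intro prob_covered_tendsto B(1) sets_cylinder)+
  have x_sum: "?x n = (\<Sum>P\<in>cover n. prob (cylinder G (q @ P)))" for n
    using prob_cover[of n "\<lambda>_. True"] by simp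
  have y_sum: "?y n = (\<Sum>P\<in>cover n. prob (cylinder G (q @ P)) * of_bool (hd P = e))" for n
  proof -
    have "hd (drop (length q) (first_steps (length q + Suc n) \<gamma>)) = path_edge \<gamma> (length q)" for \<gamma> :: "('a, 'b) ipath"
      by (subst hd_drop_conv_nth) auto
    then have "{\<gamma> \<in> cylinder G q. hd (drop (length q) (first_steps (length q + Suc n) \<gamma>)) = e} = cylinder G (q @ [e])"
      by (auto simp: cylinder_def first_steps_Suc)
    then have "?y n = (\<Sum>P | P \<in> cover n \<and> hd P = e. prob (cylinder G (q @ P)))"
      using prob_cover[of n "\<lambda>P. hd P = e"] by simp
    then show ?thesis using finite_cover by (simp add: of_bool_def if_distrib sum.If_cases Int_def)
  qed
  show ge: "1 \<le> out_potential"
  proof -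
    obtain n where "cover n \<noteq> {}"
    proof (rule ccontr)
      assume "\<not> thesis"
      then have "\<And>n. cover n = {}" using that by blast
      then have "?x = (\<lambda>n. 0)" by (simp add: x_sum)
      then show False using x nonzero LIMSEQ_const_iff by metis
    qed
    then show ?thesis using fibre_estimate(2) by blast
  qed
  show "\<bar>(out_potential - \<phi> (head G e)) * prob (cylinder G q) -
           out_potential * ?c * prob (cylinder G (q @ [e]))\<bar> \<le> out_potential * prob (late_visit a J)"
  proof (rule LIMSEQ_le_const2)
    show "(\<lambda>n. \<bar>(out_potential - \<phi> (head G e)) * ?x n - out_potential * ?c * ?y n\<bar>) \<longlonglongrightarrow>
       \<bar>(out_potential - \<phi> (head G e)) * prob (cylinder G q) - out_potential * ?c * prob (cylinder G (q @ [e]))\<bar>"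
      by (intro tendsto_intros x y)
    have "\<bar>(out_potential - \<phi> (head G e)) * ?x n - out_potential * ?c * ?y n\<bar> \<le> out_potential * prob (late_visit a J)"
      for n
    proof -
      have "(out_potential - \<phi> (head G e)) * ?x n - out_potential * ?c * ?y n =
          (\<Sum>P\<in>cover n. prob (cylinder G (q @ P)) * first_step_error P)"
        unfolding x_sum y_sum sum_distrib_left sum_subtractf[symmetric]
        by (intro sum.cong) (simp_all add: algebra_simps)
      also have "\<bar>\<dots>\<bar> \<le> out_potential * (\<Sum>P | P \<in> cover n \<and> early_exit P. prob (cylinder G (q @ P)))"
        by (rule cover_estimate)
      also have "\<dots> \<le> out_potential * prob (late_visit a J)"
        using prob_early_exit_le[OF B(2)] ge by (intro mult_left_mono) auto
      finally show ?thesis .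
    qed
    then show "\<exists>N. \<forall>n\<ge>N. \<bar>(out_potential - \<phi> (head G e)) * ?x n - out_potential * ?c * ?y n\<bar> \<le>
        out_potential * prob (late_visit a J)" by blast
  qed
qed

end

section \<open>Uniqueness\<close>

text \<open>
  By induction on the length of the cylinder. A beginning whose last vertex has a single unused
  out-arc determines the next step; otherwise both measures satisfy the same approximate
  equation for the next step, and its error tends to \<open>0\<close> as \<open>B\<close> grows.
\<close>

lemma prob_cylinder_unique:
  assumes "gibbs_measure G \<mu> r" "gibbs_measure G \<nu> r"
  shows "measure \<mu> (cylinder G p) = measure \<nu> (cylinder G p)"
proof (induction p rule: rev_induct)
  case Nil
  interpret M: gibbs_measure G \<mu> r by fact
  interpret N: gibbs_measure G \<nu> r by fact
  have "cylinder G [] = space \<mu>" "space \<nu> = space \<mu>" by (simp_all add: cylinder_def)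
  then show ?case using M.prob_space N.prob_space by simp
next
  case (snoc e q)
  interpret M: gibbs_measure G \<mu> r by fact
  interpret N: gibbs_measure G \<nu> r by fact
  show ?case
  proof (cases "q @ [e] \<in> walks G r (length (q @ [e])) \<and> M.prob (cylinder G q) \<noteq> 0")
    case False
    then have "M.prob (cylinder G (q @ [e])) = 0" "N.prob (cylinder G (q @ [e])) = 0"
      using M.prob_cylinder_nonzero[of "q @ [e]"] N.prob_cylinder_nonzero[of "q @ [e]"] snoc
        M.prob_cylinder_snoc_le[of q e] N.prob_cylinder_snoc_le[of q e]
      by (metis measure_le_0_iff)+
    then show ?thesis by simp
  next
    case True
    then obtain a where a: "M.cas r q a" "tail G e = a" and q: "distinct q" "set q \<subseteq> arcs G"
        and e: "e \<in> arcs G" "e \<notin> set q"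
      by (auto simp: walks_def M.cas_append_ex simp del: M.cas_append_iff)
    let ?O = "out_arcs G a - set q"
    define c where "c = real (card ?O - 1)"
    have finO: "finite ?O" and eO: "e \<in> ?O" using M.finite_out a e by auto
    show ?thesis
    proof (cases "?O = {e}")
      case True
      then show ?thesis
        using M.prob_cylinder_forced[OF a(1)] N.prob_cylinder_forced[OF a(1)] snoc by simp
    next
      case False
      have "{e} \<subset> ?O" using eO False by blast
      then have "1 < card ?O"
        using psubset_card_mono[OF finO, of "{e}"] by simp
      then have c: "1 \<le> c" by (simp add: c_def)
      let ?y = "M.prob (cylinder G (q @ [e]))" and ?z = "N.prob (cylinder G (q @ [e]))"
      have "\<bar>?y - ?z\<bar> \<le> M.prob (M.late_visit a J) + N.prob (N.late_visit a J)" for J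
      proof -
        \<comment> \<open>\<open>B\<close> and \<open>\<phi>\<close> are chosen once for both measures.\<close>
        define B where "B = insert a (reach G r J)"
        have B: "finite B" "reach G r J \<subseteq> B" "a \<in> B" using M.finite_reach by (auto simp: B_def)
        obtain \<phi> :: "'a \<Rightarrow> real" where \<phi>: "\<phi> a = 0" "\<And>v. v \<notin> B \<Longrightarrow> \<phi> v = 1" "\<And>v. \<phi> v \<le> 1"
            "\<And>v. v \<in> B \<Longrightarrow> v \<noteq> a \<Longrightarrow> (\<Sum>f\<in>out_arcs G v - set q. \<phi> v - \<phi> (head G f)) = 0"
          using exists_potential[of "\<lambda>v. out_arcs G v - set q" a B "head G"] M.finite_out B(3)
          by (metis finite_Diff)
        interpret M': gibbs_continuation G \<mu> r q a B \<phi> e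
          by unfold_locales (use a q B \<phi> eO in auto)
        interpret N': gibbs_continuation G \<nu> r q a B \<phi> e
          by unfold_locales (use a q B \<phi> eO in auto)
        let ?\<Phi> = "M'.out_potential"
        have nz: "M.prob (cylinder G q) \<noteq> 0" "N.prob (cylinder G q) \<noteq> 0" using True snoc by auto
        have ge: "1 \<le> ?\<Phi>" using M'.continuation_estimate(2)[OF B(1,2) nz(1)] .
        have "\<bar>?\<Phi> * c * ?y - ?\<Phi> * c * ?z\<bar> \<le> ?\<Phi> * M.prob (M.late_visit a J) + ?\<Phi> * N.prob (N.late_visit a J)"
          using M'.continuation_estimate(1)[OF B(1,2) nz(1)] N'.continuation_estimate(1)[OF B(1,2) nz(2)]
          unfolding snoc c_def by linarith
        then have "?\<Phi> * (c * \<bar>?y - ?z\<bar>) \<le> ?\<Phi> * (M.prob (M.late_visit a J) + N.prob (N.late_visit a J))"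
          using ge c by (simp add: right_diff_distrib[symmetric] abs_mult distrib_left mult.assoc)
        then have "c * \<bar>?y - ?z\<bar> \<le> M.prob (M.late_visit a J) + N.prob (N.late_visit a J)"
          using ge by simp
        moreover have "1 * \<bar>?y - ?z\<bar> \<le> c * \<bar>?y - ?z\<bar>" using c by (rule mult_right_mono) simp
        ultimately show ?thesis by simp
      qed
      moreover have "(\<lambda>J. M.prob (M.late_visit a J) + N.prob (N.late_visit a J)) \<longlonglongrightarrow> 0"
        using tendsto_add[OF M.prob_late_visit_tendsto_0 N.prob_late_visit_tendsto_0] by simp
      ultimately have "\<bar>?y - ?z\<bar> \<le> 0" by (intro LIMSEQ_le_const[of _ 0]) auto
      then show ?thesis by simp
    qed
  qed
qed

theorem theorem1p3:
  fixes G :: "('a, 'b) pre_digraph" and r :: 'a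
  assumes "eulerian_sourced_digraph G r"
  shows "\<exists>\<^sub>\<le>\<^sub>1 \<mu>. proper_gibbs_measure G r \<mu>"
proof (rule Uniq_I)
  fix \<mu> \<nu> assume gibbs: "proper_gibbs_measure G r \<mu>" "proper_gibbs_measure G r \<nu>"
  have G: "wf_digraph G" "countable (verts G)" "countable (arcs G)"
      "\<And>v. v \<in> verts G \<Longrightarrow> finite (out_arcs G v)"
    using assms by (auto simp: eulerian_sourced_digraph_def infinite_sourced_digraph_def)
  have measures: "gibbs_measure G \<rho> r" if "proper_gibbs_measure G r \<rho>" for \<rho>
    using G that
    by (simp add: gibbs_measure_def gibbs_measure_axioms_def proper_gibbs_measure_def)
  show "\<mu> = \<nu>"
    using gibbs G measures
    by (intro path_measure_eqI[of \<mu> \<nu> G] prob_cylinder_unique[of G \<mu> r \<nu>])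
       (auto simp: proper_gibbs_measure_def)
qed

end
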